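(* Let $d=1$ and let $b,\sigma:\mathbb R\to\mathbb R$ be Borel measurable functions such that $b$, $\sigma$ and $\sigma^{-1}=1/\sigma$ are bounded. Let $X=(X_t)_{t\ge0}$ and $X'=(X'_t)_{t\ge 0}$ be two independent solutions of the SDE $dX_t=b(X_t)\,dt+\sigma(X_t)\,dW_t$ with initial values $X_0=x$ and $X'_0=x'$, and let $P_{x,x'}$ denote their joint law. Then $$\inf_{-1\le x,x'\le 1}P_{x,x'}\bigl(\exists\, s\in[0,1]:\ X_s=X'_s\bigr)>0 .$$ Moreover, the first meeting time $\tau:=\inf\{t\ge 0: X_t=X'_t\}$ is a stopping time.
   Context: The SDE is understood as $X_t=x+\int_0^t b(X_s)\,ds+\int_0^t\sigma(X_s)\,dW_s$, $t\ge0$, with $W$ a one-dimensional Wiener process. Standing assumption: the equation has a (weak or strong) solution for each initial value, and these solutions form a (time-homogeneous) strong Markov process. The two solutions $X$ and $X'$ are two independent versions of this strong Markov process, with different (independent) driving Wiener processes, realised on the direct product of their probability spaces; $P_{x,x'}$ is the corresponding product law. "Stopping time" is with respect to the filtration generated by the pair $(X,X')$. *)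

theory Defs
  imports "HOL-Probability.Probability"
begin

text \<open>
  Processes are functions \<open>X t \<omega>\<close> of a real time \<open>t\<close>; only the times \<open>t \<ge> 0\<close> matter.
\<close>

definition filtered_prob_space :: "'a measure \<Rightarrow> (real \<Rightarrow> 'a measure) \<Rightarrow> bool" where
  "filtered_prob_space M F \<longleftrightarrow>
     prob_space M \<and>
     (\<forall>t\<ge>0. subalgebra M (F t)) \<and>
     (\<forall>s t. 0 \<le> s \<and> s \<le> t \<longrightarrow> sets (F s) \<subseteq> sets (F t))"

definition continuous_adapted ::
    "'a measure \<Rightarrow> (real \<Rightarrow> 'a measure) \<Rightarrow> (real \<Rightarrow> 'a \<Rightarrow> real) \<Rightarrow> bool" where
  "continuous_adapted M F X \<longleftrightarrow>
     (\<forall>t\<ge>0. X t \<in> borel_measurable (F t)) \<and>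
     (\<forall>\<omega>\<in>space M. continuous_on {0..} (\<lambda>t. X t \<omega>))"

definition wiener_process ::
    "'a measure \<Rightarrow> (real \<Rightarrow> 'a measure) \<Rightarrow> (real \<Rightarrow> 'a \<Rightarrow> real) \<Rightarrow> bool" where
  "wiener_process M F W \<longleftrightarrow>
     continuous_adapted M F W \<and>
     (AE \<omega> in M. W 0 \<omega> = 0) \<and>
     (\<forall>s t. 0 \<le> s \<and> s < t \<longrightarrow>
        distributed M lborel (\<lambda>\<omega>. W t \<omega> - W s \<omega>) (normal_density 0 (sqrt (t - s))) \<and>
        prob_space.indep_set M (sets (F s))
          (sets (vimage_algebra (space M) (\<lambda>\<omega>. W t \<omega> - W s \<omega>) borel)))"

text \<open>
  The list entry \<open>(u, v, \<xi>)\<close> stands for the process \<open>\<xi> 1\<^bsub>(u,v]\<^esub>\<close>, and a list for the sum of its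
  entries.
\<close>

type_synonym 'a simple_proc = "(real \<times> real \<times> ('a \<Rightarrow> real)) list"

definition simple_predictable ::
    "'a measure \<Rightarrow> (real \<Rightarrow> 'a measure) \<Rightarrow> 'a simple_proc \<Rightarrow> bool" where
  "simple_predictable M F S \<longleftrightarrow>
     (\<forall>(u, v, \<xi>)\<in>set S. 0 \<le> u \<and> u \<le> v \<and> \<xi> \<in> borel_measurable (F u) \<and> bounded (\<xi> ` space M))"

definition simple_value :: "'a simple_proc \<Rightarrow> real \<Rightarrow> 'a \<Rightarrow> real" where
  "simple_value S s \<omega> = (\<Sum>(u, v, \<xi>)\<leftarrow>S. \<xi> \<omega> * indicator {u<..v} s)"

definition simple_integral ::
    "(real \<Rightarrow> 'a \<Rightarrow> real) \<Rightarrow> 'a simple_proc \<Rightarrow> real \<Rightarrow> 'a \<Rightarrow> real" where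
  "simple_integral W S t \<omega> = (\<Sum>(u, v, \<xi>)\<leftarrow>S. \<xi> \<omega> * (W (min t v) \<omega> - W (min t u) \<omega>))"

definition progressively_measurable ::
    "(real \<Rightarrow> 'a measure) \<Rightarrow> (real \<Rightarrow> 'a \<Rightarrow> real) \<Rightarrow> bool" where
  "progressively_measurable F H \<longleftrightarrow>
     (\<forall>t\<ge>0. (\<lambda>(s, \<omega>). H s \<omega>) \<in> borel_measurable (restrict_space borel {0..t} \<Otimes>\<^sub>M F t))"

text \<open>
  \<open>has_ito_integral M F W H t J\<close>: the random variable \<open>J\<close> is a version of \<open>\<integral>\<^sub>0\<^sup>t H\<^sub>s dW\<^sub>s\<close>, i.e. the
  \<open>L\<^sup>2(M)\<close> limit of the integrals of simple processes which converge to \<open>H\<close> in \<open>L\<^sup>2([0,t] \<times> M)\<close>.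
  By the Ito isometry \<open>J\<close> does not depend, up to null sets, on the approximating sequence. The
  notion covers integrands with \<open>E \<integral>\<^sub>0\<^sup>t H\<^sub>s\<^sup>2 ds < \<infinity>\<close>, in particular all bounded ones.
\<close>

definition has_ito_integral ::
    "'a measure \<Rightarrow> (real \<Rightarrow> 'a measure) \<Rightarrow> (real \<Rightarrow> 'a \<Rightarrow> real) \<Rightarrow> (real \<Rightarrow> 'a \<Rightarrow> real) \<Rightarrow>
     real \<Rightarrow> ('a \<Rightarrow> real) \<Rightarrow> bool" where
  "has_ito_integral M F W H t J \<longleftrightarrow>
     progressively_measurable F H \<and> J \<in> borel_measurable M \<and>
     (\<exists>S :: nat \<Rightarrow> 'a simple_proc.
        (\<forall>n. simple_predictable M F (S n)) \<and>
        (\<lambda>n. \<integral>\<^sup>+\<omega>. (\<integral>\<^sup>+s\<in>{0..t}. ennreal ((simple_value (S n) s \<omega> - H s \<omega>)\<^sup>2) \<partial>lborel) \<partial>M)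
          \<longlonglongrightarrow> 0 \<and>
        (\<lambda>n. \<integral>\<^sup>+\<omega>. ennreal ((simple_integral W (S n) t \<omega> - J \<omega>)\<^sup>2) \<partial>M) \<longlonglongrightarrow> 0)"

text \<open>
  The equation is required almost surely for each \<open>t\<close>. As \<open>X\<close> has continuous paths, this is the
  same as requiring it almost surely for all \<open>t\<close> with the continuous version of the integral.
\<close>

definition sde_solution ::
    "(real \<Rightarrow> real) \<Rightarrow> (real \<Rightarrow> real) \<Rightarrow> real \<Rightarrow>
     'a measure \<Rightarrow> (real \<Rightarrow> 'a measure) \<Rightarrow> (real \<Rightarrow> 'a \<Rightarrow> real) \<Rightarrow> (real \<Rightarrow> 'a \<Rightarrow> real) \<Rightarrow> bool" where
  "sde_solution b \<sigma> x M F W X \<longleftrightarrow>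
     filtered_prob_space M F \<and> wiener_process M F W \<and> continuous_adapted M F X \<and>
     (AE \<omega> in M. X 0 \<omega> = x) \<and>
     (\<forall>t\<ge>0. \<exists>J. has_ito_integral M F W (\<lambda>s \<omega>. \<sigma> (X s \<omega>)) t J \<and>
        (AE \<omega> in M. X t \<omega> = x + (LINT s:{0..t}|lborel. b (X s \<omega>)) + J \<omega>))"

text \<open>
  Stopping times may be infinite, so these filtrations are indexed by \<open>[0,\<infinity>]\<close>; the index \<open>\<infinity>\<close>
  gives the \<open>\<sigma>\<close>-algebra of the whole process.
\<close>

definition natural_filtration ::
    "'a measure \<Rightarrow> (real \<Rightarrow> 'a \<Rightarrow> 'b::topological_space) \<Rightarrow> ennreal \<Rightarrow> 'a measure" where
  "natural_filtration M Z t =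
     sigma (space M) {Z s -` A \<inter> space M | s A. 0 \<le> s \<and> ennreal s \<le> t \<and> A \<in> sets borel}"

lemma filtration_natural_filtration: "filtration (space M) (natural_filtration M Z)"
proof
  show "space (natural_filtration M Z i) = space M" for i
    unfolding natural_filtration_def by (rule space_measure_of) auto
  show "sets (natural_filtration M Z i) \<le> sets (natural_filtration M Z j)" if "i \<le> j" for i j
    unfolding natural_filtration_def using that
    by (subst (1 2) sets_measure_of) (auto intro!: sigma_sets_mono' intro: order_trans)
qed

abbreviation path_space :: "(real \<Rightarrow> real) measure" where
  "path_space \<equiv> PiM {0..} (\<lambda>_. borel)"

definition path_law :: "'a measure \<Rightarrow> (real \<Rightarrow> 'a \<Rightarrow> real) \<Rightarrow> (real \<Rightarrow> real) measure" where
  "path_law M X = distr M path_space (\<lambda>\<omega>. \<lambda>t\<in>{0..}. X t \<omega>)"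

text \<open>
  \<open>X x\<close> is the process started at \<open>x\<close>, living on \<open>M x\<close>. On \<open>{\<tau> < \<infinity>}\<close>, the conditional law of
  \<open>(X\<^bsub>\<tau>+t\<^esub>)\<^bsub>t\<ge>0\<^esub>\<close> given the past of \<open>\<tau>\<close> is the law of the process started at \<open>X\<^sub>\<tau>\<close>.
\<close>

definition strong_markov_family ::
    "(real \<Rightarrow> 'a measure) \<Rightarrow> (real \<Rightarrow> real \<Rightarrow> 'a \<Rightarrow> real) \<Rightarrow> bool" where
  "strong_markov_family M X \<longleftrightarrow>
     (\<lambda>x. path_law (M x) (X x)) \<in> borel \<rightarrow>\<^sub>M prob_algebra path_space \<and>
     (\<forall>x \<tau>. stopping_time (natural_filtration (M x) (X x)) \<tau> \<longrightarrow>
       (\<forall>B\<in>sets path_space. AE \<omega> in M x. \<tau> \<omega> < \<infinity> \<longrightarrow>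
          real_cond_exp (M x)
            (filtration.pre_sigma (space (M x)) (natural_filtration (M x) (X x)) \<tau>)
            (indicator {\<omega>\<in>space (M x). \<tau> \<omega> < \<infinity> \<and>
               (\<lambda>t\<in>{0..}. X x (enn2real (\<tau> \<omega>) + t) \<omega>) \<in> B}) \<omega>
          = (let y = X x (enn2real (\<tau> \<omega>)) \<omega> in measure (path_law (M y) (X y)) B)))"

definition pair_process ::
    "(real \<Rightarrow> 'a \<Rightarrow> real) \<Rightarrow> (real \<Rightarrow> 'b \<Rightarrow> real) \<Rightarrow> real \<Rightarrow> 'a \<times> 'b \<Rightarrow> real \<times> real" where
  "pair_process X X' t \<omega> = (X t (fst \<omega>), X' t (snd \<omega>))"

definition meeting_time :: "(real \<Rightarrow> 'a \<Rightarrow> real \<times> real) \<Rightarrow> 'a \<Rightarrow> ennreal" where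
  "meeting_time Z \<omega> = (INF t\<in>{t. 0 \<le> t \<and> fst (Z t \<omega>) = snd (Z t \<omega>)}. ennreal t)"

end

theory Submission
  imports Defs
begin

text \<open>
  Two continuous paths which start in one order and are in the opposite order at time 1 have met.
  As the copies are independent, it suffices to bound \<open>P(X\<^sub>1 > 1)\<close> and \<open>P(X\<^sub>1 < -1)\<close> from below,
  uniformly in \<open>x \<in> [-1, 1]\<close>. Let \<open>J = \<integral>\<^sub>0\<^sup>1 \<sigma>(X) dW\<close> and \<open>m \<le> \<bar>\<sigma>\<bar> \<le> K\<close>. The
  variable \<open>Y = exp (a J - a\<^sup>2/2 \<integral>\<^sub>0\<^sup>1 \<sigma>(X)\<^sup>2 ds)\<close> has mean 1 and second moment at most
  \<open>exp (a\<^sup>2 K\<^sup>2)\<close>, so by Paley-Zygmund \<open>Y \<ge> 1/2\<close>, and hence \<open>a J \<ge> a\<^sup>2 m\<^sup>2/2 - ln 2\<close>, with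
  probability at least \<open>exp (- a\<^sup>2 K\<^sup>2)/4\<close>. For \<open>\<bar>a\<bar>\<close> large this beats the drift and the
  distance to be covered; the sign of \<open>a\<close> chooses the direction. The estimate is proved, with
  worse constants, for simple integrands and passes to the limit in probability.
\<close>

section \<open>Exponential moments of a Gaussian increment\<close>

text \<open>Completing the square: the exponential factor moves the mean of the Gaussian density
  from 0 to \<open>c * \<tau>\<^sup>2\<close>, and the shifted density still has total mass
  1.\<close>

lemma nn_integral_exp_normal:
  fixes c \<tau> :: real
  assumes "0 < \<tau>"
  shows "(\<integral>\<^sup>+y. ennreal (exp (c * y - c\<^sup>2 * \<tau>\<^sup>2 / 2)) \<partial>density lborel (normal_density 0 \<tau>)) = 1"
proof -
  have "normal_density 0 \<tau> y * exp (c * y - c\<^sup>2 * \<tau>\<^sup>2 / 2) = normal_density (c * \<tau>\<^sup>2) \<tau> y" for y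
  proof -
    have "- (y\<^sup>2) / (2 * \<tau>\<^sup>2) + (c * y - c\<^sup>2 * \<tau>\<^sup>2 / 2) = - ((y - c * \<tau>\<^sup>2)\<^sup>2) / (2 * \<tau>\<^sup>2)"
      using assms by (simp add: field_simps power2_eq_square)
    then show ?thesis
      unfolding normal_density_def by (simp add: exp_add[symmetric])
  qed
  then have "(\<integral>\<^sup>+y. ennreal (exp (c * y - c\<^sup>2 * \<tau>\<^sup>2 / 2)) \<partial>density lborel (normal_density 0 \<tau>))
      = emeasure (density lborel (normal_density (c * \<tau>\<^sup>2) \<tau>)) UNIV"
    by (simp add: nn_integral_density emeasure_density ennreal_mult[symmetric])
  also have "\<dots> = 1"
    using prob_space.emeasure_space_1[OF prob_space_normal_density[OF assms]] by simp
  finally show ?thesis .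
qed

text \<open>One step of the exponential martingale, in integrated form. By independence the joint
  law of the outcome seen through \<open>G\<close> and of \<open>Y\<close> is a product. Fubini then
  freezes the \<open>G\<close>-measurable \<open>c\<close> and \<open>Z\<close>, and the inner
  Gaussian integral is 1.\<close>

lemma (in prob_space) nn_integral_exp_indep_normal:
  fixes Y c :: "'a \<Rightarrow> real"
  assumes G: "subalgebra M G"
    and Y: "distributed M lborel Y (normal_density 0 \<tau>)" and \<tau>: "0 < \<tau>"
    and indep: "indep_set (sets G) (sets (vimage_algebra (space M) Y borel))"
    and Z [measurable]: "Z \<in> borel_measurable G" and c [measurable]: "c \<in> borel_measurable G"
  shows "(\<integral>\<^sup>+\<omega>. Z \<omega> * ennreal (exp (c \<omega> * Y \<omega> - (c \<omega>)\<^sup>2 * \<tau>\<^sup>2 / 2)) \<partial>M) = (\<integral>\<^sup>+\<omega>. Z \<omega> \<partial>M)"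
proof -
  have sp: "space G = space M" and ss: "sets G \<subseteq> sets M"
    using G by (auto simp: subalgebra_def)
  have id: "(\<lambda>\<omega>. \<omega>) \<in> M \<rightarrow>\<^sub>M G"
    using measurable_from_subalg[OF G measurable_ident_sets[OF refl]] by simp
  have Ym [measurable]: "Y \<in> borel_measurable M"
    using distributed_measurable[OF Y] by simp
  interpret N: prob_space "density lborel (normal_density 0 \<tau>)"
    by (rule prob_space_normal_density[OF \<tau>])
  \<comment> \<open>Pushing \<open>M\<close> forward by the identity into \<open>G\<close> gives the
    restriction of \<open>M\<close> to the smaller sigma-algebra.\<close>
  interpret G: prob_space "distr M G (\<lambda>\<omega>. \<omega>)"
    by (rule prob_space_distr[OF id])
  have eq: "distr M G (\<lambda>\<omega>. \<omega>) \<Otimes>\<^sub>M density lborel (normal_density 0 \<tau>)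
      = distr M (G \<Otimes>\<^sub>M lborel) (\<lambda>\<omega>. (\<omega>, Y \<omega>))"
  proof (rule pair_measure_eqI)
    fix A B
    assume "A \<in> sets (distr M G (\<lambda>\<omega>. \<omega>))" "B \<in> sets (density lborel (normal_density 0 \<tau>))"
    then have AB: "A \<in> sets G" "B \<in> sets borel" by auto
    have A: "A \<inter> space M = A"
      using sets.sets_into_space[OF AB(1)] sp by auto
    have "Y -` B \<inter> space M \<in> sets (vimage_algebra (space M) Y borel)"
      using AB(2) by (rule in_vimage_algebra)
    then have "prob (A \<inter> (Y -` B \<inter> space M)) = prob A * prob (Y -` B \<inter> space M)"
      using indep AB(1) by (simp add: indep_sets2_eq)
    moreover have "(\<lambda>\<omega>. (\<omega>, Y \<omega>)) -` (A \<times> B) \<inter> space M = A \<inter> (Y -` B \<inter> space M)"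
      using sets.sets_into_space[OF AB(1)] sp by auto
    moreover have "emeasure (density lborel (normal_density 0 \<tau>)) B = emeasure M (Y -` B \<inter> space M)"
      using Y AB(2) Ym by (simp add: distributed_def emeasure_distr flip: Y[THEN distributed_distr_eq_density])
    ultimately show "emeasure (distr M G (\<lambda>\<omega>. \<omega>)) A * emeasure (density lborel (normal_density 0 \<tau>)) B
        = emeasure (distr M (G \<Otimes>\<^sub>M lborel) (\<lambda>\<omega>. (\<omega>, Y \<omega>))) (A \<times> B)"
      using AB id by (simp add: emeasure_distr A emeasure_eq_measure ennreal_mult)
  qed (auto intro: G.sigma_finite_measure_axioms N.sigma_finite_measure_axioms
      cong: sets_pair_measure_cong)
  let ?f = "\<lambda>(\<omega>, y). Z \<omega> * ennreal (exp (c \<omega> * y - (c \<omega>)\<^sup>2 * \<tau>\<^sup>2 / 2))"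
  have fm [measurable]: "?f \<in> borel_measurable (G \<Otimes>\<^sub>M lborel)"
    by measurable
  have "(\<integral>\<^sup>+\<omega>. ?f (\<omega>, Y \<omega>) \<partial>M) = (\<integral>\<^sup>+p. ?f p \<partial>distr M (G \<Otimes>\<^sub>M lborel) (\<lambda>\<omega>. (\<omega>, Y \<omega>)))"
    using id by (subst nn_integral_distr) auto
  also have "\<dots> = (\<integral>\<^sup>+\<omega>. \<integral>\<^sup>+y. ?f (\<omega>, y) \<partial>density lborel (normal_density 0 \<tau>) \<partial>distr M G (\<lambda>\<omega>. \<omega>))"
    unfolding eq[symmetric]
    by (subst N.nn_integral_fst[symmetric])
      (use fm in \<open>simp_all cong: measurable_cong_sets sets_pair_measure_cong\<close>)
  also have "\<dots> = (\<integral>\<^sup>+\<omega>. Z \<omega> \<partial>distr M G (\<lambda>\<omega>. \<omega>))"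
    by (simp add: nn_integral_cmult nn_integral_exp_normal[OF \<tau>])
  also have "\<dots> = (\<integral>\<^sup>+\<omega>. Z \<omega> \<partial>M)"
    using id by (subst nn_integral_distr) auto
  finally show ?thesis by simp
qed

section \<open>Integrals along a grid and their exponential martingales\<close>

definition grid_integral :: "(real \<Rightarrow> 'a \<Rightarrow> real) \<Rightarrow> (nat \<Rightarrow> real) \<Rightarrow> nat \<Rightarrow> (nat \<Rightarrow> 'a \<Rightarrow> real) \<Rightarrow> 'a \<Rightarrow> real" where
  "grid_integral W t n c \<omega> = (\<Sum>i<n. c i \<omega> * (W (t (Suc i)) \<omega> - W (t i) \<omega>))"

text \<open>The quadratic variation of \<open>grid_integral\<close>. Unlike the intervals of a
  \<open>simple_proc\<close>, the cells of a grid do not overlap, so there are no cross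
  terms.\<close>

definition grid_bracket :: "(nat \<Rightarrow> real) \<Rightarrow> nat \<Rightarrow> (nat \<Rightarrow> 'a \<Rightarrow> real) \<Rightarrow> 'a \<Rightarrow> real" where
  "grid_bracket t n c \<omega> = (\<Sum>i<n. (c i \<omega>)\<^sup>2 * (t (Suc i) - t i))"

lemma grid_integral_scale: "grid_integral W t n (\<lambda>i \<omega>. a * c i \<omega>) \<omega> = a * grid_integral W t n c \<omega>"
  by (simp add: grid_integral_def sum_distrib_left mult.assoc)

lemma grid_bracket_scale: "grid_bracket t n (\<lambda>i \<omega>. a * c i \<omega>) \<omega> = a\<^sup>2 * grid_bracket t n c \<omega>"
  by (simp add: grid_bracket_def sum_distrib_left power_mult_distrib mult.assoc)

locale filtered_wiener = prob_space M for M :: "'a measure" +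
  fixes F :: "real \<Rightarrow> 'a measure" and W :: "real \<Rightarrow> 'a \<Rightarrow> real"
  assumes filtered: "filtered_prob_space M F" and wiener: "wiener_process M F W"
begin

lemma subalgebra_F: "0 \<le> t \<Longrightarrow> subalgebra M (F t)"
  using filtered by (simp add: filtered_prob_space_def)

lemma measurable_F_mono: "\<lbrakk>f \<in> F s \<rightarrow>\<^sub>M N; 0 \<le> s; s \<le> t\<rbrakk> \<Longrightarrow> f \<in> F t \<rightarrow>\<^sub>M N"
  using filtered by (intro measurable_from_subalg[of "F t" "F s"])
    (auto simp: filtered_prob_space_def subalgebra_def)

lemma measurable_F_imp: "\<lbrakk>f \<in> F s \<rightarrow>\<^sub>M N; 0 \<le> s\<rbrakk> \<Longrightarrow> f \<in> M \<rightarrow>\<^sub>M N"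
  by (rule measurable_from_subalg[OF subalgebra_F])

lemma W_adapted: "\<lbrakk>0 \<le> s; s \<le> t\<rbrakk> \<Longrightarrow> W s \<in> borel_measurable (F t)"
  using wiener measurable_F_mono[of "W s" s] by (auto simp: wiener_process_def continuous_adapted_def)

end

text \<open>Each \<open>c i\<close> is known at the left end of its cell, hence independent of the
  increment that it multiplies. Strict increase of the grid keeps the variances positive, as a
  normal density requires.\<close>

locale predictable_grid = filtered_wiener +
  fixes t :: "nat \<Rightarrow> real" and n :: nat and c :: "nat \<Rightarrow> 'a \<Rightarrow> real"
  assumes t_nonneg: "0 \<le> t 0" and t_Suc: "\<And>i. i < n \<Longrightarrow> t i < t (Suc i)"
    and c_adapted: "\<And>i. i < n \<Longrightarrow> c i \<in> borel_measurable (F (t i))"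
begin

lemma t_mono: "\<lbrakk>i \<le> j; j \<le> n\<rbrakk> \<Longrightarrow> t i \<le> t j"
proof (induction j rule: dec_induct)
  case (step j) then show ?case using t_Suc[of j] by simp
qed simp

lemma t_ge_0: "i \<le> n \<Longrightarrow> 0 \<le> t i"
  using t_mono[of 0 i] t_nonneg by simp

lemma grid_measurable_F:
  assumes "k \<le> n"
  shows "grid_integral W t k c \<in> borel_measurable (F (t k))"
    and "grid_bracket t k c \<in> borel_measurable (F (t k))"
proof -
  have [measurable]: "c i \<in> borel_measurable (F (t k))" "W (t i) \<in> borel_measurable (F (t k))"
    "W (t (Suc i)) \<in> borel_measurable (F (t k))" if "i < k" for i
    using that assms t_ge_0[of i] t_ge_0[of "Suc i"] t_mono[of i k] t_mono[of "Suc i" k]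
    by (auto intro!: W_adapted measurable_F_mono[OF c_adapted])
  show "grid_integral W t k c \<in> borel_measurable (F (t k))"
    unfolding grid_integral_def[abs_def] by (intro borel_measurable_sum) measurable
  show "grid_bracket t k c \<in> borel_measurable (F (t k))"
    unfolding grid_bracket_def[abs_def] by (intro borel_measurable_sum) measurable
qed

lemma grid_measurable [measurable]:
  "grid_integral W t n c \<in> borel_measurable M" "grid_bracket t n c \<in> borel_measurable M"
  using measurable_F_imp[OF grid_measurable_F(1) t_ge_0, of n]
    measurable_F_imp[OF grid_measurable_F(2) t_ge_0, of n] by auto

lemma scale: "predictable_grid M F W t n (\<lambda>i \<omega>. a * c i \<omega>)"
  using t_nonneg t_Suc c_adapted by unfold_locales auto

text \<open>Induction on the number of cells: the last factor integrates out by
  \<open>nn_integral_exp_indep_normal\<close>. Since all integrals are of nonnegative functions,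
  unbounded coefficients cause no integrability problem.\<close>

lemma nn_integral_exp_grid:
  "(\<integral>\<^sup>+\<omega>. ennreal (exp (grid_integral W t n c \<omega> - grid_bracket t n c \<omega> / 2)) \<partial>M) = 1"
proof -
  have "(\<integral>\<^sup>+\<omega>. ennreal (exp (grid_integral W t k c \<omega> - grid_bracket t k c \<omega> / 2)) \<partial>M) = 1"
    if "k \<le> n" for k
    using that
  proof (induction k)
    case 0 then show ?case by (simp add: grid_integral_def grid_bracket_def emeasure_space_1)
  next
    case (Suc k)
    let ?E = "\<lambda>\<omega>. exp (grid_integral W t k c \<omega> - grid_bracket t k c \<omega> / 2)"
    let ?Y = "\<lambda>\<omega>. W (t (Suc k)) \<omega> - W (t k) \<omega>" and ?\<tau> = "sqrt (t (Suc k) - t k)"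
    from Suc have k: "k < n" "0 \<le> t k" "t k < t (Suc k)"
      by (auto simp: t_ge_0 t_Suc)
    note [measurable] = grid_measurable_F[OF less_imp_le[OF k(1)]] c_adapted[OF k(1)]
    have "exp (grid_integral W t (Suc k) c \<omega> - grid_bracket t (Suc k) c \<omega> / 2)
       = ?E \<omega> * exp (c k \<omega> * ?Y \<omega> - (c k \<omega>)\<^sup>2 * ?\<tau>\<^sup>2 / 2)" for \<omega>
      using k by (simp add: grid_integral_def grid_bracket_def exp_add[symmetric] add_divide_distrib)
    then have "(\<integral>\<^sup>+\<omega>. ennreal (exp (grid_integral W t (Suc k) c \<omega> - grid_bracket t (Suc k) c \<omega> / 2)) \<partial>M)
       = (\<integral>\<^sup>+\<omega>. ennreal (?E \<omega>) * ennreal (exp (c k \<omega> * ?Y \<omega> - (c k \<omega>)\<^sup>2 * ?\<tau>\<^sup>2 / 2)) \<partial>M)"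
      by (simp add: ennreal_mult)
    also have "\<dots> = (\<integral>\<^sup>+\<omega>. ennreal (?E \<omega>) \<partial>M)"
    proof (rule nn_integral_exp_indep_normal[OF subalgebra_F[OF k(2)]])
      show "distributed M lborel ?Y (normal_density 0 ?\<tau>)"
        "indep_set (sets (F (t k))) (sets (vimage_algebra (space M) ?Y borel))"
        using wiener k by (auto simp: wiener_process_def)
      show "0 < ?\<tau>" using k by simp
      show "(\<lambda>\<omega>. ennreal (?E \<omega>)) \<in> borel_measurable (F (t k))" by measurable
      show "c k \<in> borel_measurable (F (t k))" by measurable
    qed
    finally show ?case using Suc by simp
  qed
  then show ?thesis by simp
qed

text \<open>Chernoff bound: on the event, the exponential for the coefficients
  \<open>a * c i\<close> is at least \<open>exp (a * \<epsilon> - a\<^sup>2 * \<eta> / 2)\<close>,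
  while its mean is 1.\<close>

lemma exp_tail:
  assumes "0 < \<eta>" "0 < \<epsilon>"
  shows "prob {\<omega>\<in>space M. \<epsilon> \<le> grid_integral W t n c \<omega> \<and> grid_bracket t n c \<omega> \<le> \<eta>}
    \<le> exp (- \<epsilon>\<^sup>2 / (2 * \<eta>))"
proof -
  \<comment> \<open>The maximiser of \<open>a * \<epsilon> - a\<^sup>2 * \<eta> / 2\<close>; the
    maximum is \<open>\<epsilon>\<^sup>2 / (2 * \<eta>)\<close>.\<close>
  define a where "a = \<epsilon> / \<eta>"
  have a: "0 < a" using assms by (simp add: a_def)
  interpret s: predictable_grid M F W t n "\<lambda>i \<omega>. a * c i \<omega>" by (rule scale)
  let ?A = "{\<omega>\<in>space M. \<epsilon> \<le> grid_integral W t n c \<omega> \<and> grid_bracket t n c \<omega> \<le> \<eta>}"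
  have e: "a * \<epsilon> - a\<^sup>2 * \<eta> / 2 = \<epsilon>\<^sup>2 / (2 * \<eta>)"
    using assms by (simp add: a_def field_simps power2_eq_square)
  have "ennreal (exp (\<epsilon>\<^sup>2 / (2 * \<eta>))) * emeasure M ?A
      = (\<integral>\<^sup>+\<omega>. ennreal (exp (\<epsilon>\<^sup>2 / (2 * \<eta>))) * indicator ?A \<omega> \<partial>M)"
    by (subst nn_integral_cmult_indicator) auto
  also have "\<dots> \<le> (\<integral>\<^sup>+\<omega>. ennreal (exp (grid_integral W t n (\<lambda>i \<omega>. a * c i \<omega>) \<omega>
      - grid_bracket t n (\<lambda>i \<omega>. a * c i \<omega>) \<omega> / 2)) \<partial>M)"
  proof (rule nn_integral_mono)
    fix \<omega>
    have "\<epsilon>\<^sup>2 / (2 * \<eta>) \<le> a * grid_integral W t n c \<omega> - a\<^sup>2 * grid_bracket t n c \<omega> / 2" if "\<omega> \<in> ?A"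
      unfolding e[symmetric] using that a by (intro diff_mono divide_right_mono mult_left_mono) auto
    then show "ennreal (exp (\<epsilon>\<^sup>2 / (2 * \<eta>))) * indicator ?A \<omega> \<le> ennreal (exp (grid_integral W t n (\<lambda>i \<omega>. a * c i \<omega>) \<omega>
      - grid_bracket t n (\<lambda>i \<omega>. a * c i \<omega>) \<omega> / 2))"
      by (auto simp: grid_integral_scale grid_bracket_scale indicator_def intro!: ennreal_leI)
  qed
  also have "\<dots> = 1" by (rule s.nn_integral_exp_grid)
  finally have "ennreal (exp (\<epsilon>\<^sup>2 / (2 * \<eta>)) * prob ?A) \<le> ennreal 1"
    by (simp add: emeasure_eq_measure ennreal_mult)
  then have "exp (\<epsilon>\<^sup>2 / (2 * \<eta>)) * prob ?A \<le> 1" by simp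
  then show ?thesis
    by (simp add: exp_minus field_simps)
qed

lemma exp_tail_abs:
  assumes "0 < \<eta>" "0 < \<epsilon>"
  shows "prob {\<omega>\<in>space M. \<epsilon> \<le> \<bar>grid_integral W t n c \<omega>\<bar> \<and> grid_bracket t n c \<omega> \<le> \<eta>}
    \<le> 2 * exp (- \<epsilon>\<^sup>2 / (2 * \<eta>))"
proof -
  interpret s: predictable_grid M F W t n "\<lambda>i \<omega>. -1 * c i \<omega>" by (rule scale)
  let ?A = "\<lambda>s. {\<omega>\<in>space M. \<epsilon> \<le> s * grid_integral W t n c \<omega> \<and> grid_bracket t n c \<omega> \<le> \<eta>}"
  have "prob {\<omega>\<in>space M. \<epsilon> \<le> \<bar>grid_integral W t n c \<omega>\<bar> \<and> grid_bracket t n c \<omega> \<le> \<eta>}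
      \<le> prob (?A 1 \<union> ?A (-1))"
    by (intro finite_measure_mono) auto
  also have "\<dots> \<le> prob (?A 1) + prob (?A (-1))"
    by (intro measure_Un_le) auto
  also have "\<dots> \<le> 2 * exp (- \<epsilon>\<^sup>2 / (2 * \<eta>))"
    using exp_tail[OF assms] s.exp_tail[OF assms, unfolded grid_integral_scale grid_bracket_scale]
    by simp
  finally show ?thesis .
qed

text \<open>Paley-Zygmund for the exponential martingale, whose second moment is at most \<open>exp q\<close>.\<close>

lemma grid_integral_lower:
  assumes q: "\<And>\<omega>. \<omega> \<in> space M \<Longrightarrow> grid_bracket t n c \<omega> \<le> q"
  shows "exp (- q) / 4 \<le> prob {\<omega>\<in>space M. grid_bracket t n c \<omega> / 2 - ln 2 \<le> grid_integral W t n c \<omega>}"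
    (is "_ \<le> prob ?A")
proof -
  \<comment> \<open>Doubling the coefficients controls the square:
    \<open>?E \<omega> * ?E \<omega>\<close> equals \<open>?E2 \<omega> * exp (?Q \<omega>)\<close>,
    and \<open>?E2\<close> again has mean 1.\<close>
  interpret s: predictable_grid M F W t n "\<lambda>i \<omega>. 2 * c i \<omega>" by (rule scale)
  let ?I = "grid_integral W t n c" and ?Q = "grid_bracket t n c"
  let ?E = "\<lambda>\<omega>. exp (?I \<omega> - ?Q \<omega> / 2)"
  let ?E2 = "\<lambda>\<omega>. exp (grid_integral W t n (\<lambda>i \<omega>. 2 * c i \<omega>) \<omega> - grid_bracket t n (\<lambda>i \<omega>. 2 * c i \<omega>) \<omega> / 2)"
  have A [measurable]: "?A \<in> sets M" by measurable
  \<comment> \<open>This pointwise bound replaces the Cauchy-Schwarz inequality. Off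
    \<open>?A\<close> the exponential is at most 1/2; on \<open>?A\<close> the square of
    \<open>?E \<omega> / 2 - exp q\<close> being nonnegative gives the other two terms. Integrating
    yields 1 on the left and 1/2 + 1/4 + \<open>exp q * prob ?A\<close> on the right.\<close>
  have "?E \<omega> \<le> 1/2 + (?E2 \<omega> / 4 + exp q * indicator ?A \<omega>)" if w: "\<omega> \<in> space M" for \<omega>
  proof (cases "\<omega> \<in> ?A")
    case True
    have "?E \<omega> * ?E \<omega> \<le> exp q * ?E2 \<omega>"
      unfolding exp_add[symmetric] using q[OF w]
      by (simp add: grid_integral_scale grid_bracket_scale)
    moreover have "0 \<le> (?E \<omega> / 2 - exp q)\<^sup>2" by simp
    ultimately have "exp q * ?E \<omega> \<le> exp q * (?E2 \<omega> / 4 + exp q)"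
      by (simp add: power2_eq_square algebra_simps)
    then have "?E \<omega> \<le> ?E2 \<omega> / 4 + exp q"
      by (subst (asm) mult_le_cancel_left_pos) auto
    with True show ?thesis by simp
  next
    case False
    with w have "?I \<omega> - ?Q \<omega> / 2 \<le> - ln 2" by auto
    then have "?E \<omega> \<le> exp (- ln 2)" by (subst exp_le_cancel_iff)
    also have "\<dots> = 1/2" by (simp add: exp_minus)
    finally show ?thesis using False by (simp add: add_increasing2)
  qed
  then have "(\<integral>\<^sup>+\<omega>. ennreal (?E \<omega>) \<partial>M)
      \<le> (\<integral>\<^sup>+\<omega>. ennreal (1/2 + (?E2 \<omega> / 4 + exp q * indicator ?A \<omega>)) \<partial>M)"
    by (intro nn_integral_mono ennreal_leI)
  also have "\<dots> = (\<integral>\<^sup>+\<omega>. (ennreal (1/2) + (ennreal (1/4) * ennreal (?E2 \<omega>) + ennreal (exp q) * indicator ?A \<omega>)) \<partial>M)"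
  proof (rule arg_cong[where f="nn_integral M"], rule ext)
    show "ennreal (1/2 + (?E2 \<omega> / 4 + exp q * indicator ?A \<omega>))
        = ennreal (1/2) + (ennreal (1/4) * ennreal (?E2 \<omega>) + ennreal (exp q) * indicator ?A \<omega>)" for \<omega>
      by (subst ennreal_plus ennreal_mult[symmetric] | simp add: ennreal_indicator ennreal_mult)+
  qed
  also have "\<dots> = ennreal (1/2) + (ennreal (1/4) * (\<integral>\<^sup>+\<omega>. ennreal (?E2 \<omega>) \<partial>M) + ennreal (exp q) * emeasure M ?A)"
    by (simp add: nn_integral_add nn_integral_cmult nn_integral_cmult_indicator emeasure_space_1)
  also have "\<dots> = ennreal (3/4 + exp q * prob ?A)"
  proof -
    have "inverse 2 + ennreal (1/4) = ennreal (3/4)"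
      using ennreal_plus[of "1/2" "1/4"] by (simp del: ennreal_plus)
    then show ?thesis
      by (simp add: s.nn_integral_exp_grid emeasure_eq_measure ennreal_mult)
  qed
  finally have "ennreal 1 \<le> ennreal (3/4 + exp q * prob ?A)"
    by (simp add: nn_integral_exp_grid)
  then have "1 \<le> 3/4 + exp q * prob ?A" by (subst (asm) ennreal_le_iff) auto
  then show ?thesis by (simp add: exp_minus field_simps)
qed

end

section \<open>Simple processes on a common grid, and a lower bound for their integrals\<close>

lemma finite_set_as_grid:
  fixes P :: "real set"
  assumes "finite P" "P \<noteq> {}"
  obtains t n where "P = t ` {..n}" "\<And>i. i < n \<Longrightarrow> t i < t (Suc i)"
proof -
  let ?l = "sorted_list_of_set P"
  have len: "length ?l = card P" "0 < card P"
    using assms by (auto simp: card_gt_0_iff)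
  have "(!) ?l ` {..<length ?l} = P"
    using assms set_sorted_list_of_set[of P] by (auto simp: set_conv_nth)
  moreover have "{..<length ?l} = {..card P - 1}"
    using len by auto
  moreover have "?l ! i < ?l ! Suc i" if "i < card P - 1" for i
    using sorted_wrt_nth_less[OF strict_sorted_list_of_set[of P], of i "Suc i"] that len by simp
  ultimately show thesis
    using that[of "(!) ?l" "card P - 1"] by simp
qed

lemma nn_integral_step_function:
  fixes t a :: "nat \<Rightarrow> real" and f :: "real \<Rightarrow> real"
  assumes t: "\<And>i. i < n \<Longrightarrow> t i < t (Suc i)"
    and f: "\<And>i s. \<lbrakk>i < n; t i < s; s \<le> t (Suc i)\<rbrakk> \<Longrightarrow> f s = a i"
    and a: "\<And>i. i < n \<Longrightarrow> 0 \<le> a i"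
  shows "(\<integral>\<^sup>+s\<in>{t 0..t n}. ennreal (f s) \<partial>lborel) = ennreal (\<Sum>i<n. a i * (t (Suc i) - t i))"
proof -
  have mono: "t 0 \<le> t k" if "k \<le> n" for k
    using that
  proof (induction k)
    case (Suc k) then show ?case using t[of k] by simp
  qed simp
  have step: "ennreal (f s) * indicator {t 0<..t k} s = (\<Sum>i<k. ennreal (a i) * indicator {t i<..t (Suc i)} s)"
    if "k \<le> n" for k s
    using that
  proof (induction k)
    case (Suc k)
    have "ennreal (f s) * indicator {t 0<..t (Suc k)} s
        = ennreal (f s) * indicator {t 0<..t k} s + ennreal (a k) * indicator {t k<..t (Suc k)} s"
      using t[of k] f[of k s] mono[of k] Suc.prems by (auto simp: indicator_def)
    with Suc show ?case by simp
  qed simp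
  \<comment> \<open>The point \<open>t 0\<close> lies in none of the left-open cells, but it is a
    null set.\<close>
  have "AE s in lborel. ennreal (f s) * indicator {t 0..t n} s = ennreal (f s) * indicator {t 0<..t n} s"
    using AE_lborel_singleton[of "t 0"] by eventually_elim (auto simp: indicator_def)
  then have "(\<integral>\<^sup>+s\<in>{t 0..t n}. ennreal (f s) \<partial>lborel)
      = (\<integral>\<^sup>+s. (\<Sum>i<n. ennreal (a i) * indicator {t i<..t (Suc i)} s) \<partial>lborel)"
    unfolding step[OF order_refl, symmetric] by (rule nn_integral_cong_AE)
  also have "\<dots> = (\<Sum>i<n. ennreal (a i) * ennreal (t (Suc i) - t i))"
    using t by (subst nn_integral_sum) (auto intro!: sum.cong simp: nn_integral_cmult_indicator less_imp_le)
  also have "\<dots> = ennreal (\<Sum>i<n. a i * (t (Suc i) - t i))"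
    using t a by (subst sum_ennreal[symmetric]) (auto simp: ennreal_mult less_imp_le)
  finally show ?thesis .
qed

text \<open>Serves to spread the increment of \<open>W\<close> over one entry of a simple process
  across the whole grid: once clipped at the final time, both ends of the entry are grid points, and
  each contributes a telescoping sum with weights 0 and 1.\<close>

lemma sum_increments_up_to:
  fixes t :: "nat \<Rightarrow> real" and w :: "real \<Rightarrow> real"
  assumes t: "\<And>i. i < n \<Longrightarrow> t i < t (Suc i)" and "k \<le> n"
  shows "(\<Sum>i<n. (if t (Suc i) \<le> t k then 1 else 0) * (w (t (Suc i)) - w (t i))) = w (t k) - w (t 0)"
proof -
  have less: "t i < t j" if "i < j" "j \<le> n" for i j
    using that
  proof (induction j)
    case (Suc j) then show ?case using t[of j] by (cases "i = j") auto
  qed simp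
  have "(\<Sum>i<n. (if t (Suc i) \<le> t k then 1 else 0) * (w (t (Suc i)) - w (t i)))
      = (\<Sum>i<k. w (t (Suc i)) - w (t i))"
  proof (rule sum.mono_neutral_cong_right)
    show "\<forall>i\<in>{..<n} - {..<k}. (if t (Suc i) \<le> t k then 1 else 0) * (w (t (Suc i)) - w (t i)) = 0"
    proof
      fix i assume "i \<in> {..<n} - {..<k}"
      then have "t k < t (Suc i)" by (intro less) auto
      then show "(if t (Suc i) \<le> t k then 1 else 0) * (w (t (Suc i)) - w (t i)) = 0" by simp
    qed
    show "(if t (Suc i) \<le> t k then 1 else 0) * (w (t (Suc i)) - w (t i)) = w (t (Suc i)) - w (t i)"
      if "i \<in> {..<k}" for i
      using that less[of "Suc i" k] \<open>k \<le> n\<close> by (cases "Suc i = k") auto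
  qed (use \<open>k \<le> n\<close> in auto)
  also have "\<dots> = w (t k) - w (t 0)" by (rule sum_lessThan_telescope)
  finally show ?thesis .
qed

lemma simple_value_Nil [simp]: "simple_value [] s \<omega> = 0"
  and simple_value_Cons [simp]:
    "simple_value ((u, v, \<xi>) # S) s \<omega> = \<xi> \<omega> * indicator {u<..v} s + simple_value S s \<omega>"
  by (simp_all add: simple_value_def)

lemma simple_integral_Nil [simp]: "simple_integral W [] s \<omega> = 0"
  and simple_integral_Cons [simp]: "simple_integral W ((u, v, \<xi>) # S) s \<omega>
    = \<xi> \<omega> * (W (min s v) \<omega> - W (min s u) \<omega>) + simple_integral W S s \<omega>"
  by (simp_all add: simple_integral_def)

lemma simple_predictable_Nil [simp]: "simple_predictable M F []"
  and simple_predictable_Cons [simp]: "simple_predictable M F ((u, v, \<xi>) # S) \<longleftrightarrow>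
    0 \<le> u \<and> u \<le> v \<and> \<xi> \<in> borel_measurable (F u) \<and> bounded (\<xi> ` space M) \<and> simple_predictable M F S"
  by (auto simp: simple_predictable_def)

context filtered_wiener
begin

lemma simple_value_measurable:
  assumes "simple_predictable M F S"
  shows "(\<lambda>(s, \<omega>). simple_value S s \<omega>) \<in> borel_measurable (borel \<Otimes>\<^sub>M M)"
  using assms
proof (induction S)
  case (Cons e S)
  obtain u v \<xi> where e: "e = (u, v, \<xi>)" by (cases e)
  have [measurable]: "\<xi> \<in> borel_measurable M"
    using Cons.prems e by (auto intro: measurable_F_imp)
  note [measurable] = Cons.IH[unfolded split_beta']
  show ?case using Cons.prems unfolding e by (simp add: split_beta') measurable
qed (simp add: case_prod_beta')

lemma simple_integral_measurable:
  assumes "simple_predictable M F S" "0 \<le> r"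
  shows "simple_integral W S r \<in> borel_measurable M"
  using assms
proof (induction S)
  case (Cons e S)
  obtain u v \<xi> where e: "e = (u, v, \<xi>)" by (cases e)
  then have uv: "0 \<le> u" "u \<le> v" "\<xi> \<in> borel_measurable (F u)"
    using Cons.prems by auto
  have [measurable]: "\<xi> \<in> borel_measurable M" "W (min r u) \<in> borel_measurable M" "W (min r v) \<in> borel_measurable M"
    using uv Cons.prems measurable_F_imp[OF W_adapted[OF _ order_refl]]
    by (auto intro: measurable_F_imp)
  have [measurable]: "simple_integral W S r \<in> borel_measurable M" using Cons e by simp
  have "simple_integral W (e # S) r
      = (\<lambda>\<omega>. \<xi> \<omega> * (W (min r v) \<omega> - W (min r u) \<omega>) + simple_integral W S r \<omega>)"
    by (simp add: e fun_eq_iff)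
  then show ?case by simp
qed (simp add: simple_integral_def[abs_def])

text \<open>The entries of \<open>S\<close> may overlap; cutting at all their endpoints makes the
  process constant on each cell. As the intervals are left-open, the value on a cell is the one at
  its right end. It is nevertheless known at the left end, because an entry active on the cell has
  started by then.\<close>

lemma simple_process_grid:
  assumes S: "simple_predictable M F S" and r: "0 < r"
  shows "\<exists>t n. t 0 = 0 \<and> t n = r \<and> (\<forall>i<n. t i < t (Suc i))
    \<and> (\<forall>i<n. \<forall>s \<omega>. t i < s \<longrightarrow> s \<le> t (Suc i) \<longrightarrow> simple_value S s \<omega> = simple_value S (t (Suc i)) \<omega>)
    \<and> (\<forall>i<n. simple_value S (t (Suc i)) \<in> borel_measurable (F (t i)))
    \<and> (\<forall>\<omega>. simple_integral W S r \<omega> = grid_integral W t n (\<lambda>i. simple_value S (t (Suc i))) \<omega>)"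
proof -
  let ?P = "{0, r} \<union> ({0..r} \<inter> (fst ` set S \<union> (fst \<circ> snd) ` set S))"
  have "finite ?P" "?P \<noteq> {}" by auto
  then obtain t n where P: "?P = t ` {..n}" and t: "\<And>i. i < n \<Longrightarrow> t i < t (Suc i)"
    using finite_set_as_grid by metis
  have mono: "t i \<le> t j" if "i \<le> j" "j \<le> n" for i j
    using that
  proof (induction j rule: dec_induct)
    case (step j) then show ?case using t[of j] by simp
  qed simp
  have range: "0 \<le> t i" "t i \<le> r" if "i \<le> n" for i
  proof -
    have "t i \<in> ?P" using that P by blast
    then show "0 \<le> t i" "t i \<le> r" using r by auto
  qed
  have t0: "t 0 = 0"
  proof -
    have "0 \<in> t ` {..n}" unfolding P[symmetric] by simp
    then show ?thesis using mono[of 0] range[of 0] by force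
  qed
  have tn: "t n = r"
  proof -
    have "r \<in> t ` {..n}" unfolding P[symmetric] by simp
    then show ?thesis using mono[of _ n] range[of n] by force
  qed
  have sep: "p \<le> t i \<or> t (Suc i) \<le> p" if "p \<in> ?P" "i < n" for p i
  proof -
    have "p \<in> t ` {..n}" using that(1) unfolding P .
    then obtain k where k: "p = t k" "k \<le> n" by auto
    then show ?thesis using mono[of k i] mono[of "Suc i" k] that by (cases "k \<le> i") auto
  qed
  \<comment> \<open>No endpoint of an entry lies strictly inside a cell, so its position relative to
    a point of the cell can be tested at either end. The right end gives constancy on the cell, the
    left end adaptedness.\<close>
  have grid: "p < s \<longleftrightarrow> p < t (Suc i)" "p < s \<longleftrightarrow> p \<le> t i"
    if "(u, v, \<xi>) \<in> set S" "p = u \<or> p = v" "i < n" "t i < s" "s \<le> t (Suc i)" for u v \<xi> p i s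
  proof -
    have "p \<in> fst ` set S \<union> (fst \<circ> snd) ` set S"
      using that(1,2) by (force simp: image_iff)
    moreover have "0 \<le> p" using S that(1,2) by (auto simp: simple_predictable_def)
    ultimately have "p \<le> t i \<or> t (Suc i) \<le> p"
      using sep[of p i] range[of "Suc i"] that(3) by (cases "p \<le> r") auto
    then show "p < s \<longleftrightarrow> p < t (Suc i)" "p < s \<longleftrightarrow> p \<le> t i"
      using that(4,5) by auto
  qed
  have mem: "min r p \<in> t ` {..n}" if "(u, v, \<xi>) \<in> set S" "p = u \<or> p = v" for u v \<xi> p
  proof -
    have "p \<in> fst ` set S \<union> (fst \<circ> snd) ` set S"
      using that by (force simp: image_iff)
    moreover have "0 \<le> p" using S that by (auto simp: simple_predictable_def)
    ultimately have "min r p \<in> ?P" using r by (cases "p \<le> r") (auto simp: min_def)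
    then show ?thesis unfolding P .
  qed
  show ?thesis
  proof (intro exI[of _ t] exI[of _ n] conjI allI impI t0 tn t)
    show "simple_value S s \<omega> = simple_value S (t (Suc i)) \<omega>"
      if i: "i < n" "t i < s" "s \<le> t (Suc i)" for i s \<omega>
    proof -
      have "indicator {u<..v} s = (indicator {u<..v} (t (Suc i)) :: real)" if "(u, v, \<xi>) \<in> set S" for u v \<xi>
        using grid(1)[OF that _ i, of u] grid(1)[OF that _ i, of v] by (auto simp: indicator_def not_le[symmetric])
      then show ?thesis
        unfolding simple_value_def by (intro arg_cong[where f=sum_list] map_cong) auto
    qed
    show "simple_value S (t (Suc i)) \<in> borel_measurable (F (t i))" if i: "i < n" for i
    proof -
      \<comment> \<open>The induction runs over lists with entries from \<open>S\<close>, so that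
        the grid belonging to \<open>S\<close> stays fixed.\<close>
      have "simple_value S' (t (Suc i)) \<in> borel_measurable (F (t i))" if "set S' \<subseteq> set S" for S'
        using that
      proof (induction S')
        case (Cons e S')
        obtain u v \<xi> where e: "e = (u, v, \<xi>)" by (cases e)
        have *: "0 \<le> u" "\<xi> \<in> borel_measurable (F u)" and uS: "(u, v, \<xi>) \<in> set S"
          using S Cons.prems e by (auto simp: simple_predictable_def)
        note [measurable] = Cons.IH
        have "(\<lambda>\<omega>. \<xi> \<omega> * indicator {u<..v} (t (Suc i))) \<in> borel_measurable (F (t i))"
        proof (cases "u < t (Suc i)")
          case True
          then have "u \<le> t i" using grid(2)[OF uS _ i t[OF i], of u] by simp
          with * have [measurable]: "\<xi> \<in> borel_measurable (F (t i))" by (auto intro: measurable_F_mono)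
          show ?thesis by measurable
        qed simp
        then have "(\<lambda>\<omega>. \<xi> \<omega> * indicator {u<..v} (t (Suc i)) + simple_value S' (t (Suc i)) \<omega>)
            \<in> borel_measurable (F (t i))"
          using Cons by (intro borel_measurable_add) auto
        then show ?case by (simp add: e simple_value_def[abs_def])
      qed (simp add: simple_value_def[abs_def])
      then show ?thesis by simp
    qed
    show "simple_integral W S r \<omega> = grid_integral W t n (\<lambda>i. simple_value S (t (Suc i))) \<omega>" for \<omega>
    proof -
      have "simple_integral W S' r \<omega> = grid_integral W t n (\<lambda>i. simple_value S' (t (Suc i))) \<omega>"
        if "set S' \<subseteq> set S" for S'
        using that
      proof (induction S')
        case (Cons e S')
        obtain u v \<xi> where e: "e = (u, v, \<xi>)" by (cases e)
        have uv: "u \<le> v" and uS: "(u, v, \<xi>) \<in> set S"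
          using S Cons.prems e by (auto simp: simple_predictable_def)
        obtain j k where j: "min r u = t j" "j \<le> n" and k: "min r v = t k" "k \<le> n"
          using mem[OF uS, of u] mem[OF uS, of v] by auto
        let ?d = "\<lambda>i. W (t (Suc i)) \<omega> - W (t i) \<omega>"
        let ?b = "\<lambda>p i. if t (Suc i) \<le> p then 1 else 0 :: real"
        \<comment> \<open>A cell is covered by the entry iff it ends by \<open>min r v\<close> but
          not by \<open>min r u\<close>; both of these are grid points.\<close>
        have "indicator {u<..v} (t (Suc i)) = ?b (t k) i - ?b (t j) i" if "i < n" for i
          using uv range[of "Suc i"] that unfolding j(1)[symmetric] k(1)[symmetric]
          by (auto simp: indicator_def)
        then have "(\<Sum>i<n. \<xi> \<omega> * indicator {u<..v} (t (Suc i)) * ?d i)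
            = (\<Sum>i<n. \<xi> \<omega> * (?b (t k) i * ?d i - ?b (t j) i * ?d i))"
          by (intro sum.cong refl) (simp add: left_diff_distrib mult.assoc)
        also have "\<dots> = \<xi> \<omega> * (W (min r v) \<omega> - W (min r u) \<omega>)"
        proof -
          have "(\<Sum>i<n. ?b (t l) i * ?d i) = W (t l) \<omega> - W (t 0) \<omega>" if "l \<le> n" for l
            using sum_increments_up_to[where t=t, OF t that, of "\<lambda>s. W s \<omega>"] by simp
          with j k show ?thesis
            by (simp only: sum_distrib_left[symmetric] sum_subtractf) simp
        qed
        finally show ?case
          using Cons by (simp add: e grid_integral_def distrib_right sum.distrib)
      qed (simp add: grid_integral_def)
      then show ?thesis by simp
    qed
  qed
qed

text \<open>The map \<open>\<phi>\<close> lets one grid serve both for the clamped process and for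
  the remainder. The bracket is a time integral because the process is constant on each
  cell.\<close>

lemma simple_value_grid:
  assumes S: "simple_predictable M F S" and r: "0 < r" and \<phi>: "\<phi> \<in> borel_measurable borel"
    and t: "t 0 = 0" "t n = r" "\<And>i. i < n \<Longrightarrow> t i < t (Suc i)"
    and const: "\<And>i s \<omega>. \<lbrakk>i < n; t i < s; s \<le> t (Suc i)\<rbrakk> \<Longrightarrow> simple_value S s \<omega> = simple_value S (t (Suc i)) \<omega>"
    and adapted: "\<And>i. i < n \<Longrightarrow> simple_value S (t (Suc i)) \<in> borel_measurable (F (t i))"
  shows "predictable_grid M F W t n (\<lambda>i \<omega>. \<phi> (simple_value S (t (Suc i)) \<omega>))"
    and "ennreal (grid_bracket t n (\<lambda>i \<omega>. \<phi> (simple_value S (t (Suc i)) \<omega>)) \<omega>)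
      = (\<integral>\<^sup>+s\<in>{0..r}. ennreal ((\<phi> (simple_value S s \<omega>))\<^sup>2) \<partial>lborel)"
proof -
  show "predictable_grid M F W t n (\<lambda>i \<omega>. \<phi> (simple_value S (t (Suc i)) \<omega>))"
    using t by unfold_locales (auto intro: measurable_compose[OF adapted \<phi>])
  have "(\<integral>\<^sup>+s\<in>{t 0..t n}. ennreal ((\<phi> (simple_value S s \<omega>))\<^sup>2) \<partial>lborel)
      = ennreal (\<Sum>i<n. (\<phi> (simple_value S (t (Suc i)) \<omega>))\<^sup>2 * (t (Suc i) - t i))"
  proof (rule nn_integral_step_function)
    show "(\<phi> (simple_value S s \<omega>))\<^sup>2 = (\<phi> (simple_value S (t (Suc i)) \<omega>))\<^sup>2"
      if "i < n" "t i < s" "s \<le> t (Suc i)" for i s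
      using const[OF that] by metis
  qed (auto simp: t)
  then show "ennreal (grid_bracket t n (\<lambda>i \<omega>. \<phi> (simple_value S (t (Suc i)) \<omega>)) \<omega>)
      = (\<integral>\<^sup>+s\<in>{0..r}. ennreal ((\<phi> (simple_value S s \<omega>))\<^sup>2) \<partial>lborel)"
    by (simp add: grid_bracket_def t)
qed

text \<open>
  \<open>S\<close> is clamped to \<open>[-K, K]\<close>. The clamped process has bounded bracket, and the integral of the
  remainder \<open>S - clamp S\<close> is small because its bracket is at most \<open>\<integral> (S - H)\<^sup>2\<close>.
\<close>

lemma simple_integral_lower:
  fixes H :: "real \<Rightarrow> 'a \<Rightarrow> real" and J :: "'a \<Rightarrow> real"
  defines "R \<equiv> \<lambda>S \<omega>. \<integral>\<^sup>+s\<in>{0..1}. ennreal ((simple_value S s \<omega> - H s \<omega>)\<^sup>2) \<partial>lborel"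
  assumes S: "simple_predictable M F S"
    and H [measurable]: "(\<lambda>(s, \<omega>). H s \<omega>) \<in> borel_measurable (borel \<Otimes>\<^sub>M M)"
    and m: "0 < m" and bounds: "\<And>s \<omega>. \<lbrakk>s \<in> {0..1}; \<omega> \<in> space M\<rbrakk> \<Longrightarrow> m \<le> \<bar>H s \<omega>\<bar> \<and> \<bar>H s \<omega>\<bar> \<le> K"
    and J [measurable]: "J \<in> borel_measurable M"
    and \<eta>: "0 < \<eta>" "\<eta> \<le> m\<^sup>2 / 4"
  shows "R S \<in> borel_measurable M"
    and "exp (- (a\<^sup>2 * K\<^sup>2)) / 4 \<le> prob {\<omega>\<in>space M. a\<^sup>2 * m\<^sup>2 / 8 - ln 2 - \<bar>a\<bar> \<le> a * J \<omega>}
      + prob {\<omega>\<in>space M. ennreal \<eta> \<le> R S \<omega>} + 2 * exp (- 1 / (8 * \<eta>))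
      + prob {\<omega>\<in>space M. 1/2 \<le> \<bar>simple_integral W S 1 \<omega> - J \<omega>\<bar>}"
proof -
  note [measurable] = simple_value_measurable[OF S] simple_integral_measurable[OF S, of 1]
  have Sb: "(\<lambda>p. simple_value S (fst p) (snd p)) \<in> borel_measurable (borel \<Otimes>\<^sub>M M)"
    and Hb: "(\<lambda>p. H (fst p) (snd p)) \<in> borel_measurable (borel \<Otimes>\<^sub>M M)"
    using simple_value_measurable[OF S] H by (simp_all add: split_beta')
  have Rm: "(\<lambda>p. ennreal ((simple_value S (snd p) (fst p) - H (snd p) (fst p))\<^sup>2) * indicator {0..1} (snd p))
      \<in> borel_measurable (M \<Otimes>\<^sub>M lborel)"
  proof -
    have "(\<lambda>p. (snd p, fst p)) \<in> M \<Otimes>\<^sub>M lborel \<rightarrow>\<^sub>M borel \<Otimes>\<^sub>M M"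
      by (intro measurable_Pair measurable_fst measurable_compose[OF measurable_snd]) simp
    from measurable_compose[OF this Sb] measurable_compose[OF this Hb]
    have [measurable]: "(\<lambda>p. simple_value S (snd p) (fst p)) \<in> borel_measurable (M \<Otimes>\<^sub>M lborel)"
      "(\<lambda>p. H (snd p) (fst p)) \<in> borel_measurable (M \<Otimes>\<^sub>M lborel)" by simp_all
    show ?thesis by measurable
  qed
  show R [measurable]: "R S \<in> borel_measurable M"
    unfolding R_def using lborel.borel_measurable_nn_integral[of "\<lambda>\<omega> s. ennreal ((simple_value S s \<omega> - H s \<omega>)\<^sup>2) * indicator {0..1} s" M]
      Rm by (simp add: split_beta')
  define clamp where "clamp x = max (- K) (min K x)" for x
  let ?rest = "\<lambda>x. x - clamp x"
  have clampm [measurable]: "clamp \<in> borel_measurable borel"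
    unfolding clamp_def[abs_def] by measurable
  obtain t n where t: "t 0 = 0" "t n = 1" "\<And>i. i < n \<Longrightarrow> t i < t (Suc i)"
    and const: "\<And>i s \<omega>. \<lbrakk>i < n; t i < s; s \<le> t (Suc i)\<rbrakk> \<Longrightarrow> simple_value S s \<omega> = simple_value S (t (Suc i)) \<omega>"
    and adapted: "\<And>i. i < n \<Longrightarrow> simple_value S (t (Suc i)) \<in> borel_measurable (F (t i))"
    and int: "\<And>\<omega>. simple_integral W S 1 \<omega> = grid_integral W t n (\<lambda>i. simple_value S (t (Suc i))) \<omega>"
    using simple_process_grid[OF S zero_less_one] by blast
  let ?c = "\<lambda>i \<omega>. clamp (simple_value S (t (Suc i)) \<omega>)"
  let ?d = "\<lambda>i \<omega>. ?rest (simple_value S (t (Suc i)) \<omega>)"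
  have restm: "?rest \<in> borel_measurable borel" by measurable
  note gc = simple_value_grid[where t=t and n=n and \<phi>=clamp, OF S zero_less_one clampm t const adapted]
  note gd = simple_value_grid[where t=t and n=n and \<phi>="?rest", OF S zero_less_one restm t const adapted]
  interpret c: predictable_grid M F W t n ?c by (rule gc(1))
  interpret ac: predictable_grid M F W t n "\<lambda>i \<omega>. a * ?c i \<omega>" by (rule c.scale)
  interpret d: predictable_grid M F W t n ?d by (rule gd(1))
  have qc: "ennreal (grid_bracket t n ?c \<omega>) = (\<integral>\<^sup>+s\<in>{0..1}. ennreal ((clamp (simple_value S s \<omega>))\<^sup>2) \<partial>lborel)"
    and qd: "ennreal (grid_bracket t n ?d \<omega>) = (\<integral>\<^sup>+s\<in>{0..1}. ennreal ((?rest (simple_value S s \<omega>))\<^sup>2) \<partial>lborel)" for \<omega>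
    by (rule gc(2) gd(2); assumption)+
  have nonneg: "0 \<le> grid_bracket t n ?c \<omega>" "0 \<le> grid_bracket t n ?d \<omega>" for \<omega>
    unfolding grid_bracket_def using t(3) by (auto intro!: sum_nonneg simp: less_imp_le)
  \<comment> \<open>\<open>clamp\<close> is the projection onto [-K, K], which contains
    \<open>h\<close>: it brings \<open>x\<close> no further from \<open>h\<close>, and the remainder
    is the distance from \<open>x\<close> to the interval. The third bound says that the clamped
    process inherits the lower bound on \<open>h\<close> up to the approximation error.\<close>
  have clamp_bounds: "(clamp x)\<^sup>2 \<le> K\<^sup>2" "(?rest x)\<^sup>2 \<le> (x - h)\<^sup>2" "m\<^sup>2 / 2 \<le> (clamp x)\<^sup>2 + (x - h)\<^sup>2"
    if h: "m \<le> \<bar>h\<bar>" "\<bar>h\<bar> \<le> K" for x h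
  proof -
    show "(clamp x)\<^sup>2 \<le> K\<^sup>2" "(?rest x)\<^sup>2 \<le> (x - h)\<^sup>2"
      using h by (auto simp: abs_le_square_iff[symmetric] clamp_def)
    have "(clamp x - h)\<^sup>2 \<le> (x - h)\<^sup>2"
      using h by (auto simp: abs_le_square_iff[symmetric] clamp_def)
    moreover have "m\<^sup>2 \<le> h\<^sup>2" using h m by (simp add: abs_le_square_iff[symmetric])
    moreover have "h\<^sup>2 \<le> 2 * (clamp x)\<^sup>2 + 2 * (clamp x - h)\<^sup>2"
      \<comment> \<open>The difference of the two sides is exactly the square of
        \<open>2 * clamp x - h\<close>.\<close>
      using sum_squares_ge_zero[of "2 * clamp x - h" 0] by (simp add: power2_eq_square algebra_simps)
    ultimately show "m\<^sup>2 / 2 \<le> (clamp x)\<^sup>2 + (x - h)\<^sup>2" by simp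
  qed
  have qc_le: "grid_bracket t n ?c \<omega> \<le> K\<^sup>2" if w: "\<omega> \<in> space M" for \<omega>
  proof -
    have "ennreal (grid_bracket t n ?c \<omega>) \<le> (\<integral>\<^sup>+s\<in>{0..1::real}. ennreal (K\<^sup>2) \<partial>lborel)"
      unfolding qc
    proof (rule nn_integral_mono)
      show "ennreal ((clamp (simple_value S s \<omega>))\<^sup>2) * indicator {0..1} s \<le> ennreal (K\<^sup>2) * indicator {0..1} s" for s
        using clamp_bounds(1)[of "H s \<omega>"] bounds[OF _ w, of s]
        by (cases "s \<in> {0..1}") (auto intro!: ennreal_leI)
    qed
    also have "\<dots> = ennreal (K\<^sup>2)" by (simp add: nn_integral_cmult_indicator)
    finally show ?thesis by simp
  qed
  have qd_le: "ennreal (grid_bracket t n ?d \<omega>) \<le> R S \<omega>" if w: "\<omega> \<in> space M" for \<omega>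
    unfolding qd R_def
  proof (rule nn_integral_mono)
    show "ennreal ((?rest (simple_value S s \<omega>))\<^sup>2) * indicator {0..1} s
        \<le> ennreal ((simple_value S s \<omega> - H s \<omega>)\<^sup>2) * indicator {0..1} s" for s
      using clamp_bounds(2)[of "H s \<omega>" "simple_value S s \<omega>"] bounds[OF _ w, of s]
      by (cases "s \<in> {0..1}") (auto intro!: ennreal_leI)
  qed
  have qc_ge: "ennreal (m\<^sup>2 / 2) \<le> ennreal (grid_bracket t n ?c \<omega>) + R S \<omega>" if w: "\<omega> \<in> space M" for \<omega>
  proof -
    have [measurable]: "(\<lambda>s. simple_value S s \<omega>) \<in> borel_measurable borel" "(\<lambda>s. H s \<omega>) \<in> borel_measurable borel"
      using measurable_compose[OF measurable_Pair2'[OF w] Sb] measurable_compose[OF measurable_Pair2'[OF w] Hb]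
      by simp_all
    have "ennreal (m\<^sup>2 / 2) = (\<integral>\<^sup>+s\<in>{0..1::real}. ennreal (m\<^sup>2 / 2) \<partial>lborel)"
      by (simp add: nn_integral_cmult_indicator)
    also have "\<dots> \<le> (\<integral>\<^sup>+s\<in>{0..1}. (ennreal ((clamp (simple_value S s \<omega>))\<^sup>2) + ennreal ((simple_value S s \<omega> - H s \<omega>)\<^sup>2)) \<partial>lborel)"
    proof (rule nn_integral_mono)
      show "ennreal (m\<^sup>2 / 2) * indicator {0..1} s
        \<le> (ennreal ((clamp (simple_value S s \<omega>))\<^sup>2) + ennreal ((simple_value S s \<omega> - H s \<omega>)\<^sup>2)) * indicator {0..1} s" for s
        using clamp_bounds(3)[of "H s \<omega>" "simple_value S s \<omega>"] bounds[OF _ w, of s]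
        by (cases "s \<in> {0..1}") (auto simp flip: ennreal_plus intro!: ennreal_leI)
    qed
    also have "\<dots> = ennreal (grid_bracket t n ?c \<omega>) + R S \<omega>"
      unfolding qc R_def distrib_right by (intro nn_integral_add) measurable
    finally show ?thesis .
  qed
  let ?A = "{\<omega>\<in>space M. grid_bracket t n (\<lambda>i \<omega>. a * ?c i \<omega>) \<omega> / 2 - ln 2 \<le> grid_integral W t n (\<lambda>i \<omega>. a * ?c i \<omega>) \<omega>}"
  let ?G = "{\<omega>\<in>space M. a\<^sup>2 * m\<^sup>2 / 8 - ln 2 - \<bar>a\<bar> \<le> a * J \<omega>}"
  let ?B1 = "{\<omega>\<in>space M. ennreal \<eta> \<le> R S \<omega>}"
  let ?B2 = "{\<omega>\<in>space M. 1/2 \<le> \<bar>grid_integral W t n ?d \<omega>\<bar> \<and> grid_bracket t n ?d \<omega> \<le> \<eta>}"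
  let ?B3 = "{\<omega>\<in>space M. 1/2 \<le> \<bar>simple_integral W S 1 \<omega> - J \<omega>\<bar>}"
  \<comment> \<open>Outside the three exceptional events, \<open>J\<close> differs from the clamped
    integral by at most 1/2 + 1/2, which costs \<open>\<bar>a\<bar>\<close>. The clamped bracket is
    at least \<open>m\<^sup>2 / 2 - \<eta>\<close>, hence at least \<open>m\<^sup>2 / 4\<close>,
    which yields the term \<open>a\<^sup>2 * m\<^sup>2 / 8\<close>.\<close>
  have "?A \<subseteq> ?G \<union> ?B1 \<union> ?B2 \<union> ?B3"
  proof (rule subsetI, rule ccontr)
    fix \<omega> assume A: "\<omega> \<in> ?A" and "\<omega> \<notin> ?G \<union> ?B1 \<union> ?B2 \<union> ?B3"
    then have w: "\<omega> \<in> space M" and G: "a * J \<omega> < a\<^sup>2 * m\<^sup>2 / 8 - ln 2 - \<bar>a\<bar>" and B1: "R S \<omega> < ennreal \<eta>"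
      and B2: "\<not> (1/2 \<le> \<bar>grid_integral W t n ?d \<omega>\<bar> \<and> grid_bracket t n ?d \<omega> \<le> \<eta>)"
      and B3: "\<bar>simple_integral W S 1 \<omega> - J \<omega>\<bar> < 1/2" by auto
    have "ennreal (grid_bracket t n ?d \<omega>) \<le> ennreal \<eta>"
      using qd_le[OF w] B1 by simp
    with \<eta> have "grid_bracket t n ?d \<omega> \<le> \<eta>" by simp
    with B2 have I2: "\<bar>grid_integral W t n ?d \<omega>\<bar> < 1/2" by auto
    have "simple_integral W S 1 \<omega> = grid_integral W t n ?c \<omega> + grid_integral W t n ?d \<omega>"
      unfolding int grid_integral_def sum.distrib[symmetric] by (intro sum.cong) (auto simp: algebra_simps)
    with I2 B3 have IJ: "\<bar>grid_integral W t n ?c \<omega> - J \<omega>\<bar> \<le> 1" by linarith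
    have "ennreal (m\<^sup>2 / 2) \<le> ennreal (grid_bracket t n ?c \<omega>) + ennreal \<eta>"
      using qc_ge[OF w] B1 by (meson add_left_mono less_imp_le order_trans)
    also have "\<dots> = ennreal (grid_bracket t n ?c \<omega> + \<eta>)"
      using nonneg \<eta> by simp
    finally have "m\<^sup>2 / 2 \<le> grid_bracket t n ?c \<omega> + \<eta>"
      using nonneg(1)[of \<omega>] \<eta> by (subst (asm) ennreal_le_iff) auto
    with \<eta> have "m\<^sup>2 / 4 \<le> grid_bracket t n ?c \<omega>" by simp
    then have "a\<^sup>2 * (m\<^sup>2 / 4) \<le> a\<^sup>2 * grid_bracket t n ?c \<omega>"
      by (rule mult_left_mono) simp
    moreover have "\<bar>a * (grid_integral W t n ?c \<omega> - J \<omega>)\<bar> \<le> \<bar>a\<bar>"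
      using mult_left_mono[OF IJ, of "\<bar>a\<bar>"] by (simp add: abs_mult)
    ultimately show False
      using A G by (simp add: grid_integral_scale grid_bracket_scale right_diff_distrib abs_le_iff)
  qed
  moreover have meas: "?G \<in> sets M" "?B1 \<in> sets M" "?B2 \<in> sets M" "?B3 \<in> sets M"
    by measurable
  ultimately have "prob ?A \<le> prob (?G \<union> ?B1 \<union> ?B2 \<union> ?B3)"
    by (intro finite_measure_mono) auto
  also have "\<dots> \<le> prob (?G \<union> ?B1 \<union> ?B2) + prob ?B3"
    using meas by (intro measure_Un_le) auto
  also have "\<dots> \<le> prob (?G \<union> ?B1) + prob ?B2 + prob ?B3"
    using meas by (intro add_right_mono measure_Un_le) auto
  also have "\<dots> \<le> prob ?G + prob ?B1 + prob ?B2 + prob ?B3"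
    using meas by (intro add_right_mono measure_Un_le) auto
  also have "\<dots> \<le> prob ?G + prob ?B1 + 2 * exp (- (1/2)\<^sup>2 / (2 * \<eta>)) + prob ?B3"
    using d.exp_tail_abs[OF \<eta>(1), of "1/2"] by simp
  also have "- (1/2)\<^sup>2 / (2 * \<eta>) = - 1 / (8 * \<eta>)"
    by (simp add: power2_eq_square)
  finally have "prob ?A \<le> prob ?G + prob ?B1 + 2 * exp (- 1 / (8 * \<eta>)) + prob ?B3" .
  moreover have "exp (- (a\<^sup>2 * K\<^sup>2)) / 4 \<le> prob ?A"
    using qc_le by (intro ac.grid_integral_lower) (simp add: grid_bracket_scale mult_left_mono)
  ultimately show "exp (- (a\<^sup>2 * K\<^sup>2)) / 4 \<le> prob ?G + prob ?B1 + 2 * exp (- 1 / (8 * \<eta>)) + prob ?B3"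
    by simp
qed

end

section \<open>Passage to Ito integrals and to solutions of the equation\<close>

lemma (in prob_space) prob_ge_le_nn_integral:
  assumes f [measurable]: "f \<in> borel_measurable M" and \<eta>: "0 < \<eta>" and "0 \<le> p"
    and le: "(\<integral>\<^sup>+\<omega>. f \<omega> \<partial>M) \<le> ennreal (\<eta> * p)"
  shows "prob {\<omega>\<in>space M. ennreal \<eta> \<le> f \<omega>} \<le> p"
proof -
  let ?A = "{\<omega>\<in>space M. ennreal \<eta> \<le> f \<omega>}"
  have "ennreal (\<eta> * prob ?A) = (\<integral>\<^sup>+\<omega>. ennreal \<eta> * indicator ?A \<omega> \<partial>M)"
    using \<eta> by (simp add: nn_integral_cmult_indicator emeasure_eq_measure ennreal_mult)
  also have "\<dots> \<le> (\<integral>\<^sup>+\<omega>. f \<omega> \<partial>M)"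
    by (intro nn_integral_mono) (auto simp: indicator_def)
  also note le
  finally have "\<eta> * prob ?A \<le> \<eta> * p"
    using \<eta> \<open>0 \<le> p\<close> by (subst (asm) ennreal_le_iff) auto
  then show ?thesis using \<eta> by simp
qed

text \<open>A single simple process far enough in the approximating sequence suffices: it makes the
  three error terms of \<open>simple_integral_lower\<close> consume at most half of the
  bound.\<close>

lemma (in filtered_wiener) ito_integral_lower:
  assumes J: "has_ito_integral M F W H 1 J" and m: "0 < m"
    and bounds: "\<And>s \<omega>. \<lbrakk>s \<in> {0..1}; \<omega> \<in> space M\<rbrakk> \<Longrightarrow> m \<le> \<bar>H s \<omega>\<bar> \<and> \<bar>H s \<omega>\<bar> \<le> K"
  shows "exp (- (a\<^sup>2 * K\<^sup>2)) / 8 \<le> prob {\<omega>\<in>space M. a\<^sup>2 * m\<^sup>2 / 8 - ln 2 - \<bar>a\<bar> \<le> a * J \<omega>}"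
proof -
  \<comment> \<open>Progressive measurability controls \<open>H\<close> only on [0, 1]. Clipping the
    time extends it to a jointly measurable function on the whole line without changing it on
    [0, 1].\<close>
  define H' where "H' s = H (max 0 (min 1 s))" for s :: real
  define R where "R S \<omega> = (\<integral>\<^sup>+s\<in>{0..1}. ennreal ((simple_value S s \<omega> - H' s \<omega>)\<^sup>2) \<partial>lborel)" for S \<omega>
  obtain S where S: "\<And>n. simple_predictable M F (S n)"
    and lim: "(\<lambda>n. \<integral>\<^sup>+\<omega>. (\<integral>\<^sup>+s\<in>{0..1}. ennreal ((simple_value (S n) s \<omega> - H s \<omega>)\<^sup>2) \<partial>lborel) \<partial>M) \<longlonglongrightarrow> 0"
    and limJ: "(\<lambda>n. \<integral>\<^sup>+\<omega>. ennreal ((simple_integral W (S n) 1 \<omega> - J \<omega>)\<^sup>2) \<partial>M) \<longlonglongrightarrow> 0"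
    and prog: "progressively_measurable F H" and Jm [measurable]: "J \<in> borel_measurable M"
    using J unfolding has_ito_integral_def by blast
  have limR: "(\<lambda>n. \<integral>\<^sup>+\<omega>. R (S n) \<omega> \<partial>M) \<longlonglongrightarrow> 0"
  proof -
    have "(\<integral>\<^sup>+s\<in>{0..1}. ennreal ((simple_value (S n) s \<omega> - H s \<omega>)\<^sup>2) \<partial>lborel) = R (S n) \<omega>" for n \<omega>
      unfolding R_def by (intro nn_integral_cong) (auto simp: indicator_def H'_def min_def max_def)
    with lim show ?thesis by simp
  qed
  have Hm: "(\<lambda>(s, \<omega>). H' s \<omega>) \<in> borel_measurable (borel \<Otimes>\<^sub>M M)"
  proof -
    have Hp: "(\<lambda>p. H (fst p) (snd p)) \<in> borel_measurable (restrict_space borel {0..1} \<Otimes>\<^sub>M F 1)"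
      using prog by (auto simp: progressively_measurable_def split_beta')
    have clip: "(\<lambda>p. (max 0 (min 1 (fst p)), snd p)) \<in> borel \<Otimes>\<^sub>M M \<rightarrow>\<^sub>M restrict_space borel {0..1::real} \<Otimes>\<^sub>M F 1"
    proof (rule measurable_Pair)
      show "(\<lambda>p. max 0 (min 1 (fst p))) \<in> (borel :: real measure) \<Otimes>\<^sub>M M \<rightarrow>\<^sub>M restrict_space borel {0..1::real}"
        by (rule measurable_restrict_space2) (auto, measurable)
      have "(\<lambda>\<omega>. \<omega>) \<in> M \<rightarrow>\<^sub>M F 1"
        by (rule measurable_from_subalg[OF subalgebra_F measurable_ident_sets[OF refl]]) simp
      then show "snd \<in> (borel :: real measure) \<Otimes>\<^sub>M M \<rightarrow>\<^sub>M F 1"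
        by (rule measurable_compose[OF measurable_snd])
    qed
    from measurable_compose[OF clip Hp] show ?thesis
      by (simp add: H'_def split_beta')
  qed
  have bounds': "m \<le> \<bar>H' s \<omega>\<bar> \<and> \<bar>H' s \<omega>\<bar> \<le> K" if "s \<in> {0..1}" "\<omega> \<in> space M" for s \<omega>
    unfolding H'_def using that by (intro bounds) auto
  \<comment> \<open>The bound for simple integrands is \<open>6 * p\<close>; three errors of at most
    \<open>p\<close> each leave \<open>3 * p\<close>, the claimed bound.\<close>
  define p where "p = exp (- (a\<^sup>2 * K\<^sup>2)) / 24"
  have p: "0 < p" by (simp add: p_def)
  \<comment> \<open>Chosen so that \<open>1 / (8 * \<eta>)\<close> is at least
    \<open>ln (2 / p)\<close>, which brings the Gaussian tail term below \<open>p\<close>; the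
    maximum with 1 keeps \<open>L\<close> positive.\<close>
  define L where "L = max 1 (ln (2 / p))"
  define \<eta> where "\<eta> = min (m\<^sup>2 / 4) (1 / (8 * L))"
  have \<eta>: "0 < \<eta>" "\<eta> \<le> m\<^sup>2 / 4" and \<eta>L: "\<eta> \<le> 1 / (8 * L)" and L: "1 \<le> L"
    using m by (auto simp: \<eta>_def L_def)
  have "L \<le> 1 / (8 * \<eta>)" using \<eta>(1) \<eta>L L by (simp add: field_simps)
  then have "ln (2 / p) \<le> 1 / (8 * \<eta>)" by (simp add: L_def)
  then have "exp (- 1 / (8 * \<eta>)) \<le> exp (- ln (2 / p))" by simp
  also have "\<dots> = p / 2" using p by (simp add: exp_minus)
  finally have tail: "2 * exp (- 1 / (8 * \<eta>)) \<le> p" by simp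
  have "\<forall>\<^sub>F n in sequentially. (\<integral>\<^sup>+\<omega>. R (S n) \<omega> \<partial>M) < ennreal (\<eta> * p)
      \<and> (\<integral>\<^sup>+\<omega>. ennreal ((simple_integral W (S n) 1 \<omega> - J \<omega>)\<^sup>2) \<partial>M) < ennreal (1/4 * p)"
    using \<eta> p by (intro eventually_conj order_tendstoD(2)[OF limR] order_tendstoD(2)[OF limJ]) auto
  then obtain n where n: "(\<integral>\<^sup>+\<omega>. R (S n) \<omega> \<partial>M) \<le> ennreal (\<eta> * p)"
      "(\<integral>\<^sup>+\<omega>. ennreal ((simple_integral W (S n) 1 \<omega> - J \<omega>)\<^sup>2) \<partial>M) \<le> ennreal (1/4 * p)"
    using eventually_happens[of _ sequentially] by (auto intro: less_imp_le)
  note low = simple_integral_lower[OF S[of n] Hm m bounds' Jm \<eta>, folded R_def]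
  have [measurable]: "simple_integral W (S n) 1 \<in> borel_measurable M"
    using simple_integral_measurable[OF S] by simp
  have "prob {\<omega>\<in>space M. ennreal \<eta> \<le> R (S n) \<omega>} \<le> p"
    using \<eta> p n by (intro prob_ge_le_nn_integral low(1)) auto
  moreover have "prob {\<omega>\<in>space M. 1/2 \<le> \<bar>simple_integral W (S n) 1 \<omega> - J \<omega>\<bar>} \<le> p"
  proof -
    have "prob {\<omega>\<in>space M. ennreal (1/4) \<le> ennreal ((simple_integral W (S n) 1 \<omega> - J \<omega>)\<^sup>2)} \<le> p"
      using p n(2) by (intro prob_ge_le_nn_integral) auto
    moreover have "1/2 \<le> \<bar>y\<bar> \<longleftrightarrow> ennreal (1/4) \<le> ennreal (y\<^sup>2)" for y :: real
      using abs_le_square_iff[of "1/2" y] by (subst ennreal_le_iff) (auto simp: power2_eq_square)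
    ultimately show ?thesis by simp
  qed
  ultimately show ?thesis
    using low(2)[of a] tail by (simp add: p_def)
qed

text \<open>Over unit time the drift moves the solution by at most \<open>B\<close>, a loss of
  \<open>\<bar>a\<bar> * B\<close>. The initial condition is put into the event because it holds
  only almost surely, while the crossing argument works path by path.\<close>

lemma sde_solution_lower:
  assumes sol: "sde_solution b \<sigma> x M F W X"
    and b: "\<And>y. \<bar>b y\<bar> \<le> B" and m: "0 < m" and \<sigma>: "\<And>y. m \<le> \<bar>\<sigma> y\<bar>" "\<And>y. \<bar>\<sigma> y\<bar> \<le> K"
  shows "exp (- (a\<^sup>2 * K\<^sup>2)) / 8 \<le> measure M {\<omega>\<in>space M. X 0 \<omega> = x
    \<and> a\<^sup>2 * m\<^sup>2 / 8 - ln 2 - \<bar>a\<bar> - \<bar>a\<bar> * B \<le> a * (X 1 \<omega> - x)}"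
proof -
  from sol have fp: "filtered_prob_space M F" and wp: "wiener_process M F W"
    and X: "continuous_adapted M F X" and X0: "AE \<omega> in M. X 0 \<omega> = x"
    by (auto simp: sde_solution_def)
  interpret prob_space M using fp by (simp add: filtered_prob_space_def)
  interpret filtered_wiener M F W using fp wp by unfold_locales
  obtain J where J: "has_ito_integral M F W (\<lambda>s \<omega>. \<sigma> (X s \<omega>)) 1 J"
    and X1: "AE \<omega> in M. X 1 \<omega> = x + (LINT s:{0..1}|lborel. b (X s \<omega>)) + J \<omega>"
    using sol unfolding sde_solution_def by (meson zero_le_one)
  have [measurable]: "X 0 \<in> borel_measurable M" "X 1 \<in> borel_measurable M"
    using X measurable_F_imp[of "X 0" 0] measurable_F_imp[of "X 1" 1] by (auto simp: continuous_adapted_def)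
  have drift: "\<bar>LINT s:{0..1}|lborel. b (X s \<omega>)\<bar> \<le> B" for \<omega>
  proof (cases "set_integrable lborel {0..1} (\<lambda>s. b (X s \<omega>))")
    case True
    have "\<bar>LINT s:{0..1}|lborel. b (X s \<omega>)\<bar> \<le> (LINT s:{0..1}|lborel. \<bar>b (X s \<omega>)\<bar>)"
      using set_integral_norm_bound[OF True] by simp
    also have "\<dots> \<le> (LINT s:{0..1::real}|lborel. B)"
      using b by (intro set_integral_mono set_integrable_abs[OF True]) (auto simp: set_integrable_def)
    also have "\<dots> = B" by (simp add: set_lebesgue_integral_def)
    finally show ?thesis .
  next
    \<comment> \<open>A non-integrable function has integral 0 by convention, and \<open>B\<close>
      is nonnegative as a bound of an absolute value.\<close>
    case False
    then show ?thesis using b[of 0]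
      by (simp add: set_lebesgue_integral_def set_integrable_def not_integrable_integral_eq)
  qed
  have "exp (- (a\<^sup>2 * K\<^sup>2)) / 8 \<le> prob {\<omega>\<in>space M. a\<^sup>2 * m\<^sup>2 / 8 - ln 2 - \<bar>a\<bar> \<le> a * J \<omega>}"
    using ito_integral_lower[OF J m] \<sigma> by simp
  also have "\<dots> \<le> prob {\<omega>\<in>space M. X 0 \<omega> = x
    \<and> a\<^sup>2 * m\<^sup>2 / 8 - ln 2 - \<bar>a\<bar> - \<bar>a\<bar> * B \<le> a * (X 1 \<omega> - x)}"
  proof (rule finite_measure_mono_AE)
    show "AE \<omega> in M. \<omega> \<in> {\<omega>\<in>space M. a\<^sup>2 * m\<^sup>2 / 8 - ln 2 - \<bar>a\<bar> \<le> a * J \<omega>} \<longrightarrow>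
      \<omega> \<in> {\<omega>\<in>space M. X 0 \<omega> = x \<and> a\<^sup>2 * m\<^sup>2 / 8 - ln 2 - \<bar>a\<bar> - \<bar>a\<bar> * B \<le> a * (X 1 \<omega> - x)}"
      using X0 X1
    proof eventually_elim
      case (elim \<omega>)
      have "\<bar>a * (LINT s:{0..1}|lborel. b (X s \<omega>))\<bar> \<le> \<bar>a\<bar> * B"
        unfolding abs_mult by (intro mult_left_mono drift) simp
      with elim show ?case by (auto simp: distrib_left abs_le_iff)
    qed
  qed measurable
  finally show ?thesis .
qed

section \<open>Measurability of the meeting event and the stopping time property\<close>

text \<open>Reduces an uncountable union to countable operations when \<open>D\<close> is countable.
  By compactness the minimum of \<open>\<bar>f q\<bar>\<close> is attained, and arbitrarily small
  values on \<open>D\<close> force it to be 0; conversely, continuity carries a zero to nearby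
  points of \<open>D\<close>.\<close>

lemma zero_iff_dense_approx:
  fixes f :: "real \<Rightarrow> real"
  assumes cont: "continuous_on {0..r} f" and "0 \<le> r" and D: "D \<subseteq> {0..r}" "{0..r} \<subseteq> closure D"
  shows "(\<exists>s\<in>{0..r}. f s = 0) \<longleftrightarrow> (\<forall>k::nat. \<exists>q\<in>D. \<bar>f q\<bar> < inverse (real (Suc k)))"
proof
  assume "\<exists>s\<in>{0..r}. f s = 0"
  then obtain s where s: "s \<in> {0..r}" "f s = 0" by blast
  show "\<forall>k::nat. \<exists>q\<in>D. \<bar>f q\<bar> < inverse (real (Suc k))"
  proof
    fix k :: nat
    obtain d where d: "0 < d" "\<And>q. \<lbrakk>q \<in> {0..r}; dist q s < d\<rbrakk> \<Longrightarrow> dist (f q) (f s) < inverse (real (Suc k))"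
      using cont s(1) unfolding continuous_on_iff by (metis inverse_positive_iff_positive of_nat_0_less_iff zero_less_Suc)
    obtain q where "q \<in> D" "dist q s < d"
      using s(1) D(2) d(1) by (meson closure_approachable subsetD)
    moreover from this D(1) d(2) have "dist (f q) (f s) < inverse (real (Suc k))" by blast
    ultimately show "\<exists>q\<in>D. \<bar>f q\<bar> < inverse (real (Suc k))"
      using s(2) by (intro bexI[of _ q]) simp_all
  qed
next
  assume approx: "\<forall>k::nat. \<exists>q\<in>D. \<bar>f q\<bar> < inverse (real (Suc k))"
  obtain s where s: "s \<in> {0..r}" and min: "\<And>q. q \<in> {0..r} \<Longrightarrow> \<bar>f s\<bar> \<le> \<bar>f q\<bar>"
    using continuous_attains_inf[of "{0..r}" "\<lambda>q. \<bar>f q\<bar>"] \<open>0 \<le> r\<close> continuous_on_rabs[OF cont] by auto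
  have "\<bar>f s\<bar> < inverse (real (Suc k))" for k
    using approx[rule_format, of k] min D(1) by (meson le_less_trans subsetD)
  then have "f s = 0"
    using reals_Archimedean[of "\<bar>f s\<bar>"] by (metis less_asym zero_less_abs_iff)
  with s show "\<exists>s\<in>{0..r}. f s = 0" by blast
qed

lemma measurable_ex_zero:
  fixes f :: "real \<Rightarrow> 'a \<Rightarrow> real"
  assumes f: "\<And>q. \<lbrakk>0 \<le> q; q \<le> r\<rbrakk> \<Longrightarrow> f q \<in> borel_measurable Q" and r: "0 \<le> r"
    and cont: "\<And>\<omega>. \<omega> \<in> space Q \<Longrightarrow> continuous_on {0..r} (\<lambda>q. f q \<omega>)"
  shows "{\<omega>\<in>space Q. \<exists>s\<in>{0..r}. f s \<omega> = 0} \<in> sets Q"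
proof -
  obtain D where D: "countable D" "D \<subseteq> {0..r}" "{0..r} \<subseteq> closure D"
    using separable[of "{0..r}"] by blast
  have "{\<omega>\<in>space Q. \<exists>s\<in>{0..r}. f s \<omega> = 0}
      = {\<omega>\<in>space Q. \<forall>k::nat. \<exists>q\<in>D. \<bar>f q \<omega>\<bar> < inverse (real (Suc k))}"
    using zero_iff_dense_approx[OF cont r D(2,3)] by blast
  also have "\<dots> \<in> sets Q"
  proof (intro sets.sets_Collect_countable_All sets.sets_Collect_countable_Ex' D(1))
    fix k :: nat and q assume "q \<in> D"
    then have [measurable]: "f q \<in> borel_measurable Q" using D(2) by (intro f) auto
    show "{\<omega>\<in>space Q. \<bar>f q \<omega>\<bar> < inverse (real (Suc k))} \<in> sets Q" by measurable
  qed
  finally show ?thesis .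
qed

text \<open>By continuity the set of meeting times is closed, so its infimum is attained. Hence
  having met by time \<open>r\<close> is decided by the paths on [0, r] alone.\<close>

lemma meeting_time_le_iff:
  assumes cont: "continuous_on {0..} (\<lambda>t. fst (Z t \<omega>) - snd (Z t \<omega>))" and r: "0 \<le> r"
  shows "meeting_time Z \<omega> \<le> ennreal r \<longleftrightarrow> (\<exists>s\<in>{0..r}. fst (Z s \<omega>) - snd (Z s \<omega>) = 0)"
proof
  let ?T = "{t. 0 \<le> t \<and> fst (Z t \<omega>) = snd (Z t \<omega>)}"
  assume le: "meeting_time Z \<omega> \<le> ennreal r"
  \<comment> \<open>The infimum over the empty set is infinity, which exceeds
    \<open>ennreal r\<close>.\<close>
  then have "?T \<noteq> {}" by (auto simp: meeting_time_def top_unique simp del: Collect_empty_eq)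
  moreover have "closed ?T"
    using continuous_closed_preimage_constant[OF cont, of 0] by simp
  moreover have bdd: "bdd_below ?T" by (auto intro: bdd_belowI[of _ 0])
  ultimately have Inf: "Inf ?T \<in> ?T" by (intro closed_contains_Inf)
  have "ennreal (Inf ?T) \<le> meeting_time Z \<omega>"
    unfolding meeting_time_def using bdd by (intro INF_greatest ennreal_leI cInf_lower) auto
  with le have "Inf ?T \<le> r" using r by (metis ennreal_le_iff order_trans)
  with Inf show "\<exists>s\<in>{0..r}. fst (Z s \<omega>) - snd (Z s \<omega>) = 0"
    by (intro bexI[of _ "Inf ?T"]) auto
next
  assume "\<exists>s\<in>{0..r}. fst (Z s \<omega>) - snd (Z s \<omega>) = 0"
  then obtain s where "s \<in> {0..r}" "fst (Z s \<omega>) - snd (Z s \<omega>) = 0" by blast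
  then show "meeting_time Z \<omega> \<le> ennreal r"
    unfolding meeting_time_def by (intro INF_lower2[of s] ennreal_leI) auto
qed

text \<open>\<open>measurable_ex_zero\<close> is applied with the sigma-algebra generated up to the
  given time in place of the full one; this is possible because it evaluates the paths only at times
  up to \<open>r\<close>.\<close>

lemma stopping_time_meeting_time:
  assumes cont: "\<And>\<omega>. \<omega> \<in> space Q \<Longrightarrow> continuous_on {0..} (\<lambda>t. fst (Z t \<omega>) - snd (Z t \<omega>) :: real)"
  shows "stopping_time (natural_filtration Q Z) (meeting_time Z)"
proof (rule stopping_timeI)
  fix t :: ennreal
  let ?N = "natural_filtration Q Z t"
  interpret filtration "space Q" "natural_filtration Q Z" by (rule filtration_natural_filtration)
  show "Measurable.pred ?N (\<lambda>\<omega>. meeting_time Z \<omega> \<le> t)"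
  proof (cases t rule: ennreal_cases)
    case (real r)
    have Z: "Z q \<in> borel_measurable ?N" if "0 \<le> q" "q \<le> r" for q
    proof (rule measurableI)
      fix A :: "(real \<times> real) set" assume "A \<in> sets borel"
      then show "Z q -` A \<inter> space ?N \<in> sets ?N"
        unfolding space_F unfolding natural_filtration_def real using that
        by (subst sets_measure_of) (auto intro!: sigma_sets.Basic ennreal_leI)
    qed simp
    have "{\<omega>\<in>space ?N. \<exists>s\<in>{0..r}. fst (Z s \<omega>) - snd (Z s \<omega>) = 0} \<in> sets ?N"
    proof (rule measurable_ex_zero[OF _ real(1)])
      fix q assume "0 \<le> q" "q \<le> r"
      note Z[OF this]
      then show "(\<lambda>\<omega>. fst (Z q \<omega>) - snd (Z q \<omega>)) \<in> borel_measurable ?N"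
        by (rule measurable_compose) (intro borel_measurable_continuous_onI continuous_intros)
    next
      fix \<omega> assume "\<omega> \<in> space ?N"
      then show "continuous_on {0..r} (\<lambda>q. fst (Z q \<omega>) - snd (Z q \<omega>))"
        using continuous_on_subset[OF cont, of \<omega> "{0..r}"] by (simp add: space_F)
    qed
    also have "{\<omega>\<in>space ?N. \<exists>s\<in>{0..r}. fst (Z s \<omega>) - snd (Z s \<omega>) = 0}
        = {\<omega>\<in>space ?N. meeting_time Z \<omega> \<le> t}"
      using meeting_time_le_iff[where Z=Z, OF cont real(1)] unfolding real(2) space_F by blast
    finally show ?thesis by (simp add: pred_def)
  \<comment> \<open>At the index infinity the event is the whole space.\<close>
  qed simp
qed

section \<open>Crossing of two independent copies\<close>

lemma continuous_paths_meet:
  fixes f g :: "real \<Rightarrow> real"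
  assumes "continuous_on {0..1} f" "continuous_on {0..1} g" "f 0 \<le> g 0" "g 1 \<le> f 1"
  shows "\<exists>s\<in>{0..1}. f s = g s"
  using IVT'[of "\<lambda>s. f s - g s" 0 0 1] continuous_on_diff[OF assms(1,2)] assms(3,4) by force

theorem proposition1:
  fixes b \<sigma> :: "real \<Rightarrow> real"
    and M :: "real \<Rightarrow> 'a measure"
    and F :: "real \<Rightarrow> real \<Rightarrow> 'a measure"
    and W X :: "real \<Rightarrow> real \<Rightarrow> 'a \<Rightarrow> real"
  assumes "b \<in> borel_measurable borel" and "\<sigma> \<in> borel_measurable borel"
    and "bounded (range b)" and "bounded (range \<sigma>)"
    and "\<And>y. \<sigma> y \<noteq> 0" and "bounded (range (\<lambda>y. 1 / \<sigma> y))"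
    and "\<And>x. sde_solution b \<sigma> x (M x) (F x) (W x) (X x)"
    and "strong_markov_family M X"
  shows "(INF (x, x')\<in>{-1..1} \<times> {-1..1}.
            \<P>(\<omega> in M x \<Otimes>\<^sub>M M x'. \<exists>s\<in>{0..1}. X x s (fst \<omega>) = X x' s (snd \<omega>))) > 0
    \<and> (\<forall>x x'. stopping_time
            (natural_filtration (M x \<Otimes>\<^sub>M M x') (pair_process (X x) (X x')))
            (meeting_time (pair_process (X x) (X x'))))"
proof
  note sol = assms(7)
  have cont: "continuous_on {0..} (\<lambda>t. X x t \<omega>)" if "\<omega> \<in> space (M x)" for x \<omega>
    using sol[of x] that by (auto simp: sde_solution_def continuous_adapted_def)
  have cont_diff: "continuous_on {0..} (\<lambda>t. X x t (fst \<omega>) - X x' t (snd \<omega>))"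
    if "\<omega> \<in> space (M x \<Otimes>\<^sub>M M x')" for x x' \<omega>
    using that by (intro continuous_on_diff cont) (auto simp: space_pair_measure)
  have prob: "prob_space (M x)" for x
    using sol[of x] by (auto simp: sde_solution_def filtered_prob_space_def)
  have meas: "X x t \<in> borel_measurable (M x)" if "0 \<le> t" for x t
    using sol[of x] that
    by (auto simp: sde_solution_def filtered_prob_space_def continuous_adapted_def intro: measurable_from_subalg)
  show "\<forall>x x'. stopping_time
            (natural_filtration (M x \<Otimes>\<^sub>M M x') (pair_process (X x) (X x')))
            (meeting_time (pair_process (X x) (X x')))"
    using cont_diff by (auto intro!: stopping_time_meeting_time simp: pair_process_def)

  obtain B where B: "\<And>y. \<bar>b y\<bar> \<le> B"
    using assms(3) by (auto simp: bounded_iff)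
  obtain K where K: "\<And>y. \<bar>\<sigma> y\<bar> \<le> K"
    using assms(4) by (auto simp: bounded_iff)
  obtain C where C: "0 < C" "\<And>y. \<bar>1 / \<sigma> y\<bar> \<le> C"
    using assms(6) by (auto simp: bounded_pos)
  define m where "m = 1 / C"
  have m: "0 < m" "m \<le> \<bar>\<sigma> y\<bar>" for y
    using C(1) C(2)[of y] assms(5)[of y] by (auto simp: m_def field_simps)
  \<comment> \<open>Makes \<open>a * m\<^sup>2 / 8\<close> at least \<open>B + 4\<close>. After the
    losses \<open>a * B\<close>, \<open>a\<close> and \<open>ln 2\<close> (less than
    \<open>a\<close>), more than \<open>2 * a\<close> remains, so the displacement exceeds 2, the
    largest distance from a point of [-1, 1] to 1 or to -1.\<close>
  define a where "a = 8 * (B + 4) / m\<^sup>2 + 1"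
  have B0: "0 \<le> B" using B[of 0] by simp
  have a1: "1 \<le> a" using B0 by (simp add: a_def)
  have "a * (B + 4) \<le> a * (a * m\<^sup>2 / 8)"
    using a1 m(1) by (intro mult_left_mono) (auto simp: a_def field_simps)
  moreover have "ln 2 < (1::real)" using ln_2_less_1 .
  ultimately have a: "2 * a < a\<^sup>2 * m\<^sup>2 / 8 - ln 2 - \<bar>a\<bar> - \<bar>a\<bar> * B"
    using a1 by (simp add: power2_eq_square algebra_simps)
  define p where "p = exp (- (a\<^sup>2 * K\<^sup>2)) / 8"
  have p: "0 < p" by (simp add: p_def)

  define Up where "Up x = {\<omega>\<in>space (M x). X x 0 \<omega> = x \<and> 1 < X x 1 \<omega>}" for x
  define Dn where "Dn x = {\<omega>\<in>space (M x). X x 0 \<omega> = x \<and> X x 1 \<omega> < -1}" for x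
  have sets: "Up x \<in> sets (M x)" "Dn x \<in> sets (M x)" for x
    using meas[of 0 x] meas[of 1 x] unfolding Up_def Dn_def by measurable
  have Up: "p \<le> measure (M x) (Up x)" and Dn: "p \<le> measure (M x) (Dn x)" if x: "x \<in> {-1..1}" for x
  proof -
    interpret prob_space "M x" by (rule prob)
    \<comment> \<open>The sign \<open>s\<close> selects the direction: 1 for \<open>Up\<close>, -1
      for \<open>Dn\<close>. The left side of the hypothesis is the same for both.\<close>
    have *: "2 < s * (X x 1 \<omega> - x)"
      if "s = 1 \<or> s = -1" "(s * a)\<^sup>2 * m\<^sup>2 / 8 - ln 2 - \<bar>s * a\<bar> - \<bar>s * a\<bar> * B \<le> s * a * (X x 1 \<omega> - x)" for s \<omega>
    proof -
      have "a * 2 < a * (s * (X x 1 \<omega> - x))"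
        using that a by (auto simp: mult_ac)
      then show ?thesis using a1 by simp
    qed
    note low = sde_solution_lower[OF sol[of x] B m K]
    have "p \<le> prob {\<omega>\<in>space (M x). X x 0 \<omega> = x
      \<and> (1 * a)\<^sup>2 * m\<^sup>2 / 8 - ln 2 - \<bar>1 * a\<bar> - \<bar>1 * a\<bar> * B \<le> 1 * a * (X x 1 \<omega> - x)}"
      using low[of "1 * a"] by (simp add: p_def)
    also have "\<dots> \<le> prob (Up x)"
    proof (rule finite_measure_mono[OF subsetI sets(1)])
      fix \<omega> assume "\<omega> \<in> {\<omega>\<in>space (M x). X x 0 \<omega> = x
        \<and> (1 * a)\<^sup>2 * m\<^sup>2 / 8 - ln 2 - \<bar>1 * a\<bar> - \<bar>1 * a\<bar> * B \<le> 1 * a * (X x 1 \<omega> - x)}"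
      then show "\<omega> \<in> Up x"
        using *[of 1 \<omega>] x by (simp add: Up_def)
    qed
    finally show "p \<le> prob (Up x)" .
    have "p \<le> prob {\<omega>\<in>space (M x). X x 0 \<omega> = x
      \<and> (-1 * a)\<^sup>2 * m\<^sup>2 / 8 - ln 2 - \<bar>-1 * a\<bar> - \<bar>-1 * a\<bar> * B \<le> -1 * a * (X x 1 \<omega> - x)}"
      using low[of "-1 * a"] by (simp add: p_def)
    also have "\<dots> \<le> prob (Dn x)"
    proof (rule finite_measure_mono[OF subsetI sets(2)])
      fix \<omega> assume "\<omega> \<in> {\<omega>\<in>space (M x). X x 0 \<omega> = x
        \<and> (-1 * a)\<^sup>2 * m\<^sup>2 / 8 - ln 2 - \<bar>-1 * a\<bar> - \<bar>-1 * a\<bar> * B \<le> -1 * a * (X x 1 \<omega> - x)}"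
      then show "\<omega> \<in> Dn x"
        using *[of "-1" \<omega>] x by (simp add: Dn_def)
    qed
    finally show "p \<le> prob (Dn x)" .
  qed
  have "p * p \<le> \<P>(\<omega> in M x \<Otimes>\<^sub>M M x'. \<exists>s\<in>{0..1}. X x s (fst \<omega>) = X x' s (snd \<omega>))"
    (is "_ \<le> measure ?P ?E") if xx: "x \<in> {-1..1}" "x' \<in> {-1..1}" for x x'
  proof -
    interpret A: prob_space "M x" by (rule prob)
    interpret A': prob_space "M x'" by (rule prob)
    interpret P: pair_prob_space "M x" "M x'" ..
    \<comment> \<open>Monotonicity of the measure needs this: \<open>measure\<close> gives a
      non-measurable set the value 0.\<close>
    have E: "?E \<in> sets ?P"
    proof -
      have "{\<omega>\<in>space ?P. \<exists>s\<in>{0..1}. X x s (fst \<omega>) - X x' s (snd \<omega>) = 0} \<in> sets ?P"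
      proof (rule measurable_ex_zero)
        fix q :: real assume "0 \<le> q"
        then have [measurable]: "X x q \<in> borel_measurable (M x)" "X x' q \<in> borel_measurable (M x')"
          by (auto intro: meas)
        show "(\<lambda>\<omega>. X x q (fst \<omega>) - X x' q (snd \<omega>)) \<in> borel_measurable ?P" by measurable
      next
        show "continuous_on {0..1} (\<lambda>q. X x q (fst \<omega>) - X x' q (snd \<omega>))" if "\<omega> \<in> space ?P" for \<omega>
          using cont_diff[OF that] by (rule continuous_on_subset) auto
      qed simp
      then show ?thesis by simp
    qed
    have times: "p * p \<le> measure ?P ?E"
      if A: "p \<le> A.prob A" "A \<in> sets (M x)" and A': "p \<le> A'.prob A'" "A' \<in> sets (M x')" and sub: "A \<times> A' \<subseteq> ?E" for A A'
    proof -
      have "p * p \<le> A.prob A * A'.prob A'"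
        using A A' p by (intro mult_mono) auto
      also have "\<dots> = P.prob (A \<times> A')"
        using A(2) A'(2) by (simp add: measure_def A'.emeasure_pair_measure_Times enn2real_mult)
      also have "\<dots> \<le> measure ?P ?E" using sub E by (rule P.finite_measure_mono)
      finally show ?thesis .
    qed
    have cont': "continuous_on {0..1} (\<lambda>t. X y t \<omega>)" if "\<omega> \<in> space (M y)" for y \<omega>
      using cont[OF that] by (rule continuous_on_subset) auto
    show ?thesis
    \<comment> \<open>The lower starting point is sent up and the upper one down, so the order of
      the two paths is reversed at time 1.\<close>
    proof (cases "x \<le> x'")
      case True
      have "Up x \<times> Dn x' \<subseteq> ?E"
      proof safe
        fix \<omega> \<omega>' assume "\<omega> \<in> Up x" "\<omega>' \<in> Dn x'"
        with True continuous_paths_meet[OF cont' cont', of \<omega> x \<omega>' x']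
        show "(\<omega>, \<omega>') \<in> space ?P" "\<exists>s\<in>{0..1}. X x s (fst (\<omega>, \<omega>')) = X x' s (snd (\<omega>, \<omega>'))"
          by (auto simp: Up_def Dn_def space_pair_measure)
      qed
      then show ?thesis using Up Dn sets xx by (intro times)
    next
      case False
      have "Dn x \<times> Up x' \<subseteq> ?E"
      proof safe
        fix \<omega> \<omega>' assume "\<omega> \<in> Dn x" "\<omega>' \<in> Up x'"
        with False continuous_paths_meet[OF cont' cont', of \<omega>' x' \<omega> x]
        show "(\<omega>, \<omega>') \<in> space ?P" "\<exists>s\<in>{0..1}. X x s (fst (\<omega>, \<omega>')) = X x' s (snd (\<omega>, \<omega>'))"
          by (auto simp: Up_def Dn_def space_pair_measure eq_commute)
      qed
      then show ?thesis using Up Dn sets xx by (intro times)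
    qed
  qed
  then have "p * p \<le> (INF (x, x')\<in>{-1..1} \<times> {-1..1}.
            \<P>(\<omega> in M x \<Otimes>\<^sub>M M x'. \<exists>s\<in>{0..1}. X x s (fst \<omega>) = X x' s (snd \<omega>)))"
    by (intro cINF_greatest) auto
  with p show "(INF (x, x')\<in>{-1..1} \<times> {-1..1}.
            \<P>(\<omega> in M x \<Otimes>\<^sub>M M x'. \<exists>s\<in>{0..1}. X x s (fst \<omega>) = X x' s (snd \<omega>))) > 0"
    by (smt (verit) mult_pos_pos)
qed

end
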